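(* Let $F$ be a perfect idyll. Let $N=[\nu]$ and $M=[\mu]$ be $F$-matroids of respective ranks $w$ and $r$ on respective finite sets $S$ and $T$, with respective Grassmann-Plücker functions $\nu$ and $\mu$. Let $\Phi$ be a submonomial $F$-matrix indexed by $T\times S$. Then the following are equivalent: \begin{enumerate} \item $\Phi:N\to M$ is a morphism, i.e. $\Phi\cdot\mathcal V_N\subseteq\mathcal V_M$; \item $\Phi^{-1}(M)$ is a quotient of $N$, i.e. $\mathcal V_N\subseteq\mathcal V_{\Phi^{-1}(M)}$; \item $\Phi\cdot\mathcal C_N\perp\mathcal C_M^\ast$; \item for all $y_0,\dots,y_w\in S$ and $x_2,\dots,x_r\in T$, \[ \sum_{k=0}^{w}(-1)^k\cdot\nu(y_0,\dots,\widehat{y_k},\dots,y_w)\cdot\Phi_{\underline\Phi(y_k),y_k}\cdot\mu\big(\underline\Phi(y_k),x_2,\dots,x_r\big)\ \in\ N_F, \] with the convention that $\Phi_{0,y_k}=\mu(0,x_2,\dots,x_r)=0$. \end{enumerate}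
   Context: An idyll is a commutative multiplicative monoid $F$ with an element $0$ satisfying $0\cdot a=0$ for all $a$ and such that $F^\times=F\setminus\{0\}$ is an abelian group, together with a subset $N_F$ (the nullset) of the group semiring $\mathbb N[F^\times]$ (where $0\in F$ is identified with the empty sum) such that $0\in N_F$, $1\notin N_F$, $N_F+N_F\subseteq N_F$, $\mathbb N[F^\times]\cdot N_F\subseteq N_F$, and there is a unique element $-1\in F^\times$ with $1+(-1)\in N_F$. Let $E$ be a finite set and $r\ge 0$. A Grassmann-Plücker function of rank $r$ on $E$ with coefficients in $F$ is a nonzero function $\varphi:E^r\to F$ that is alternating (i.e. $\varphi(x_{\sigma(1)},\dots,x_{\sigma(r)})=\mathrm{sign}(\sigma)\varphi(x_1,\dots,x_r)$ for all permutations $\sigma$, and $\varphi(x_1,\dots,x_r)=0$ if the $x_i$ are not pairwise distinct) and satisfies $\sum_{k=0}^r(-1)^k\varphi(y_0,\dots,\widehat{y_k},\dots,y_r)\varphi(y_k,x_2,\dots,x_r)\in N_F$ for all $x_2,\dots,x_r,y_0,\dots,y_r\in E$. (For $r=0$ there are no conditions involving tuples $x_2,\dots,x_r$.) An $F$-matroid of rank $r$ on $E$ is a class $M=[\varphi]$ of such functions up to multiplication by elements of $F^\times$. Dual: fix a total order on $E$ and let $n=\#E$; $M^*=[\varphi^*]$ with $\varphi^*:E^{n-r}\to F$, $\varphi^*(x)=0$ if $x$ has repeated entries, and $\varphi^*(x)=\mathrm{sign}(x,x')\varphi(x')$ otherwise, where $x'\in E^r$ lists the complement of the entries of $x$ and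 $\mathrm{sign}(x,x')\in\{\pm1\}$ is the sign of the permutation sorting $(x,x')$. Circuits: $\mathcal C_M\subseteq F^E$ consists of all $aX_y$ with $a\in F^\times$ and $y=(y_0,\dots,y_r)\in E^{r+1}$ with distinct entries and $\varphi(y_0,\dots,\widehat{y_k},\dots,y_r)\ne0$ for some $k$, where $X_y(y_i)=(-1)^i\varphi(y_0,\dots,\widehat{y_i},\dots,y_r)$ and $X_y(x)=0$ for other $x$. Cocircuits: $\mathcal C_M^*=\mathcal C_{M^*}$. For $X,Y\in F^E$ write $X\perp Y$ if $\sum_{e}X_eY_e\in N_F$; for subsets $\mathcal X,\mathcal Y\subseteq F^E$ write $\mathcal X\perp\mathcal Y$ if $X\perp Y$ for all $X\in\mathcal X$, $Y\in\mathcal Y$. Vectors: $\mathcal V_M=\{X\in F^E: X\perp Y\ \forall Y\in\mathcal C_M^*\}$. Covectors: $\mathcal V_M^*=\{X\in F^E:X\perp Y\ \forall Y\in\mathcal C_M\}$. The idyll $F$ is perfect if $\mathcal V_M\perp\mathcal V_M^*$ for all $F$-matroids $M$. A submonomial $F$-matrix indexed by $T\times S$ is a matrix $\Phi=(\Phi_{i,j})_{(i,j)\in T\times S}$ with entries in $F$ such that each row and each column has at most one nonzero entry; it defines a map $F^S\to F^T$, $(\Phi\cdot X)_i=\sum_{j}\Phi_{i,j}X_j$ (at most one nonzero term). Its underlying map $\underline\Phi:S\sqcup\{0\}\to T\sqcup\{0\}$ is given by $\underline\Phi(j)=i$ if $j\in S$ and $\Phi_{i,j}\ne0$, and $\underline\Phi(j)=0$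 if $j=0$ or $\Phi_{i,j}=0$ for all $i\in T$. The pre-image $\Phi^{-1}(M)$ is the unique $F$-matroid on $S$ whose vector set is $\{V\in F^S\mid\Phi\cdot V\in\mathcal V_M\}$. For $F$-matroids $N,N'$ on the same set, $N'$ is a quotient of $N$ if $\mathcal V_N\subseteq\mathcal V_{N'}$. *)

theory Defs
  imports "HOL-Library.Multiset" "HOL-Combinatorics.Permutations"
begin

section \<open>Idylls\<close>

text \<open>
  The group semiring of \<open>F - {0}\<close> with coefficients in the natural numbers is the type of
  finite multisets over \<open>F\<close> that do not contain 0.  Its addition is multiset union and its
  product is the following convolution.
\<close>

definition (in times) formal_prod :: "'a multiset \<Rightarrow> 'a multiset \<Rightarrow> 'a multiset" where
  "formal_prod A B = (\<Sum>a\<in>#A. image_mset (\<lambda>b. a * b) B)"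

class idyll = comm_monoid_mult + mult_zero + zero_neq_one +
  fixes nullset :: "'a multiset set"
  assumes unit_group: "a \<noteq> 0 \<Longrightarrow> \<exists>b. a * b = 1"
    and nullset_semiring: "A \<in> nullset \<Longrightarrow> 0 \<notin># A"
    and nullset_empty: "{#} \<in> nullset"
    and nullset_one: "{#1#} \<notin> nullset"
    and nullset_add: "A \<in> nullset \<Longrightarrow> B \<in> nullset \<Longrightarrow> A + B \<in> nullset"
    and nullset_prod: "0 \<notin># A \<Longrightarrow> B \<in> nullset \<Longrightarrow> formal_prod A B \<in> nullset"
    and nullset_neg: "\<exists>!e. e \<noteq> 0 \<and> {#1, e#} \<in> nullset"

definition neg_one :: "'f::idyll" where
  "neg_one = (THE e. e \<noteq> 0 \<and> {#1, e#} \<in> nullset)"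

text \<open>The element 0 is identified with the empty sum, so zero terms are dropped.\<close>

definition formal_sum :: "('i \<Rightarrow> 'f::idyll) \<Rightarrow> 'i set \<Rightarrow> 'f multiset" where
  "formal_sum f I = {#a \<in># image_mset f (mset_set I). a \<noteq> 0#}"

definition idyll_sign :: "(nat \<Rightarrow> nat) \<Rightarrow> 'f::idyll" where
  "idyll_sign p = (if evenperm p then 1 else neg_one)"


section \<open>Grassmann-Pluecker functions and matroids\<close>

text \<open>
  Tuples are lists, with entries numbered from 0.  A map from \<open>E\<^sup>r\<close> to \<open>F\<close> is represented by
  a function on lists that vanishes outside \<open>tuples E r\<close>, and an element of \<open>F\<^sup>E\<close> by a
  function that vanishes outside \<open>E\<close>.
\<close>

definition tuples :: "'e set \<Rightarrow> nat \<Rightarrow> 'e list set" where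
  "tuples E r = {x. length x = r \<and> set x \<subseteq> E}"

definition vecs :: "'e set \<Rightarrow> ('e \<Rightarrow> 'f::idyll) set" where
  "vecs E = {X. \<forall>e. e \<notin> E \<longrightarrow> X e = 0}"

definition omit :: "nat \<Rightarrow> 'e list \<Rightarrow> 'e list" where
  "omit k x = take k x @ drop (Suc k) x"

definition alternating :: "'e set \<Rightarrow> nat \<Rightarrow> ('e list \<Rightarrow> 'f::idyll) \<Rightarrow> bool" where
  "alternating E r \<phi> \<longleftrightarrow>
     (\<forall>x\<in>tuples E r. \<forall>p. p permutes {..<r} \<longrightarrow> \<phi> (permute_list p x) = idyll_sign p * \<phi> x) \<and>
     (\<forall>x\<in>tuples E r. \<not> distinct x \<longrightarrow> \<phi> x = 0)"

text \<open>
  In the last clause \<open>x\<close> is the tuple \<open>(x\<^sub>2, \<dots>, x\<^sub>r)\<close>; for \<open>r = 0\<close> there is no such tuple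
  and the clause is vacuous.
\<close>

definition grassmann_pluecker :: "'e set \<Rightarrow> nat \<Rightarrow> ('e list \<Rightarrow> 'f::idyll) \<Rightarrow> bool" where
  "grassmann_pluecker E r \<phi> \<longleftrightarrow>
     (\<forall>x. x \<notin> tuples E r \<longrightarrow> \<phi> x = 0) \<and>
     (\<exists>x\<in>tuples E r. \<phi> x \<noteq> 0) \<and>
     alternating E r \<phi> \<and>
     (\<forall>x y. set x \<subseteq> E \<and> Suc (length x) = r \<and> y \<in> tuples E (Suc r) \<longrightarrow>
        formal_sum (\<lambda>k. neg_one ^ k * \<phi> (omit k y) * \<phi> (y ! k # x)) {..r} \<in> nullset)"

definition gp_class :: "('e list \<Rightarrow> 'f::idyll) \<Rightarrow> ('e list \<Rightarrow> 'f) set" where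
  "gp_class \<phi> = {(\<lambda>x. a * \<phi> x) | a. a \<noteq> 0}"

datatype ('e, 'f) fmatroid =
  FMatroid (ground: "'e set") (matroid_rank: nat) (gp_functions: "('e list \<Rightarrow> 'f) set")

definition fmatroid_of :: "'e set \<Rightarrow> nat \<Rightarrow> ('e list \<Rightarrow> 'f::idyll) \<Rightarrow> ('e, 'f) fmatroid" where
  "fmatroid_of E r \<phi> = FMatroid E r (gp_class \<phi>)"

definition is_fmatroid :: "('e, 'f::idyll) fmatroid \<Rightarrow> bool" where
  "is_fmatroid M \<longleftrightarrow>
     (\<exists>E r \<phi>. finite E \<and> grassmann_pluecker E r \<phi> \<and> M = fmatroid_of E r \<phi>)"


section \<open>Duality\<close>

text \<open>
  The dual matroid depends neither on the chosen total order of the ground set nor on the order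
  in which the complement of a tuple is listed.
\<close>

definition ground_order :: "'e set \<Rightarrow> 'e rel" where
  "ground_order E = (SOME R. linear_order_on E R)"

definition sort_sign :: "'e set \<Rightarrow> 'e list \<Rightarrow> 'f::idyll" where
  "sort_sign E z = idyll_sign (THE p. p permutes {..<length z} \<and>
     sorted_wrt (\<lambda>a b. (a, b) \<in> ground_order E) (permute_list p z))"

definition complement_list :: "'e set \<Rightarrow> 'e list \<Rightarrow> 'e list" where
  "complement_list E x = (SOME x'. distinct x' \<and> set x' = E - set x)"

definition dual_gp :: "'e set \<Rightarrow> nat \<Rightarrow> ('e list \<Rightarrow> 'f::idyll) \<Rightarrow> 'e list \<Rightarrow> 'f" where
  "dual_gp E r \<phi> x =
     (if x \<in> tuples E (card E - r) \<and> distinct x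
      then sort_sign E (x @ complement_list E x) * \<phi> (complement_list E x) else 0)"

definition dual_matroid :: "('e, 'f::idyll) fmatroid \<Rightarrow> ('e, 'f) fmatroid" where
  "dual_matroid M = FMatroid (ground M) (card (ground M) - matroid_rank M)
     (dual_gp (ground M) (matroid_rank M) ` gp_functions M)"


section \<open>Circuits and vectors\<close>

definition circuit_vec :: "('e list \<Rightarrow> 'f::idyll) \<Rightarrow> 'e list \<Rightarrow> 'e \<Rightarrow> 'f" where
  "circuit_vec \<phi> y e =
     (if e \<in> set y
      then (let i = (THE i. i < length y \<and> y ! i = e) in neg_one ^ i * \<phi> (omit i y))
      else 0)"

definition circuits :: "('e, 'f::idyll) fmatroid \<Rightarrow> ('e \<Rightarrow> 'f) set" where
  "circuits M = {(\<lambda>e. a * circuit_vec \<phi> y e) | a \<phi> y.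
     a \<noteq> 0 \<and> \<phi> \<in> gp_functions M \<and> y \<in> tuples (ground M) (Suc (matroid_rank M)) \<and>
     distinct y \<and> (\<exists>k\<le>matroid_rank M. \<phi> (omit k y) \<noteq> 0)}"

definition cocircuits :: "('e, 'f::idyll) fmatroid \<Rightarrow> ('e \<Rightarrow> 'f) set" where
  "cocircuits M = circuits (dual_matroid M)"

definition perp :: "'e set \<Rightarrow> ('e \<Rightarrow> 'f::idyll) \<Rightarrow> ('e \<Rightarrow> 'f) \<Rightarrow> bool" where
  "perp E X Y \<longleftrightarrow> formal_sum (\<lambda>e. X e * Y e) E \<in> nullset"

definition perp_sets :: "'e set \<Rightarrow> ('e \<Rightarrow> 'f::idyll) set \<Rightarrow> ('e \<Rightarrow> 'f) set \<Rightarrow> bool" where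
  "perp_sets E \<X> \<Y> \<longleftrightarrow> (\<forall>X\<in>\<X>. \<forall>Y\<in>\<Y>. perp E X Y)"

definition vectors :: "('e, 'f::idyll) fmatroid \<Rightarrow> ('e \<Rightarrow> 'f) set" where
  "vectors M = {X \<in> vecs (ground M). \<forall>Y\<in>cocircuits M. perp (ground M) X Y}"

definition covectors :: "('e, 'f::idyll) fmatroid \<Rightarrow> ('e \<Rightarrow> 'f) set" where
  "covectors M = {X \<in> vecs (ground M). \<forall>Y\<in>circuits M. perp (ground M) X Y}"

text \<open>
  Perfection quantifies over matroids on all finite sets.  Since HOL cannot quantify over types
  inside a formula, ground sets are finite sets of natural numbers, which represent all
  finite sets up to bijection.
\<close>

definition perfect_idyll :: "'f::idyll itself \<Rightarrow> bool" where
  "perfect_idyll _ \<longleftrightarrow>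
     (\<forall>M :: (nat, 'f) fmatroid. is_fmatroid M \<longrightarrow> perp_sets (ground M) (vectors M) (covectors M))"


section \<open>Submonomial matrices\<close>

text \<open>
  A matrix indexed by \<open>T \<times> S\<close> is a function of which only the values on \<open>T \<times> S\<close> matter.
\<close>

definition submonomial :: "'t set \<Rightarrow> 's set \<Rightarrow> ('t \<Rightarrow> 's \<Rightarrow> 'f::idyll) \<Rightarrow> bool" where
  "submonomial T S \<Phi> \<longleftrightarrow>
     (\<forall>i\<in>T. \<forall>j\<in>S. \<forall>j'\<in>S. \<Phi> i j \<noteq> 0 \<and> \<Phi> i j' \<noteq> 0 \<longrightarrow> j = j') \<and>
     (\<forall>j\<in>S. \<forall>i\<in>T. \<forall>i'\<in>T. \<Phi> i j \<noteq> 0 \<and> \<Phi> i' j \<noteq> 0 \<longrightarrow> i = i')"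

text \<open>The sum over \<open>j\<close> of \<open>\<Phi> i j * X j\<close> has at most one nonzero term.\<close>

definition mat_apply ::
    "'t set \<Rightarrow> 's set \<Rightarrow> ('t \<Rightarrow> 's \<Rightarrow> 'f::idyll) \<Rightarrow> ('s \<Rightarrow> 'f) \<Rightarrow> 't \<Rightarrow> 'f" where
  "mat_apply T S \<Phi> X i =
     (if i \<in> T \<and> (\<exists>j\<in>S. \<Phi> i j \<noteq> 0)
      then (let j = (THE j. j \<in> S \<and> \<Phi> i j \<noteq> 0) in \<Phi> i j * X j) else 0)"

text \<open>The adjoined point 0 of \<open>S \<squnion> {0}\<close> and of \<open>T \<squnion> {0}\<close> is \<open>None\<close>.\<close>

fun underlying_map :: "'t set \<Rightarrow> ('t \<Rightarrow> 's \<Rightarrow> 'f::idyll) \<Rightarrow> 's option \<Rightarrow> 't option" where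
  "underlying_map T \<Phi> None = None"
| "underlying_map T \<Phi> (Some j) =
     (if \<exists>i\<in>T. \<Phi> i j \<noteq> 0 then Some (THE i. i \<in> T \<and> \<Phi> i j \<noteq> 0) else None)"

fun entry0 :: "('t \<Rightarrow> 's \<Rightarrow> 'f::idyll) \<Rightarrow> 't option \<Rightarrow> 's \<Rightarrow> 'f" where
  "entry0 \<Phi> None j = 0"
| "entry0 \<Phi> (Some i) j = \<Phi> i j"

fun eval0 :: "('t list \<Rightarrow> 'f::idyll) \<Rightarrow> 't option \<Rightarrow> 't list \<Rightarrow> 'f" where
  "eval0 \<mu> None x = 0"
| "eval0 \<mu> (Some i) x = \<mu> (i # x)"

definition is_morphism ::
    "('t \<Rightarrow> 's \<Rightarrow> 'f::idyll) \<Rightarrow> ('s, 'f) fmatroid \<Rightarrow> ('t, 'f) fmatroid \<Rightarrow> bool" where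
  "is_morphism \<Phi> N M \<longleftrightarrow>
     submonomial (ground M) (ground N) \<Phi> \<and>
     mat_apply (ground M) (ground N) \<Phi> ` vectors N \<subseteq> vectors M"

definition preimage_matroid ::
    "'s set \<Rightarrow> ('t \<Rightarrow> 's \<Rightarrow> 'f::idyll) \<Rightarrow> ('t, 'f) fmatroid \<Rightarrow> ('s, 'f) fmatroid" where
  "preimage_matroid S \<Phi> M =
     (THE P. is_fmatroid P \<and> ground P = S \<and>
        vectors P = {V \<in> vecs S. mat_apply (ground M) S \<Phi> V \<in> vectors M})"

definition is_quotient :: "('e, 'f::idyll) fmatroid \<Rightarrow> ('e, 'f) fmatroid \<Rightarrow> bool" where
  "is_quotient N' N \<longleftrightarrow>
     is_fmatroid N' \<and> is_fmatroid N \<and> ground N' = ground N \<and> vectors N \<subseteq> vectors N'"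

end

theory Submission
  imports Defs
begin

text \<open>
  The cocircuits of the matroid of \<open>\<mu>\<close> are its nonzero rows \<open>e \<mapsto> \<mu>(e, x)\<close> up to scalars
  (\<open>cocircuits_iff\<close>), and the Pluecker relations say that circuits are orthogonal to rows.  The
  transpose of \<open>\<Phi>\<close> is adjoint to \<open>\<Phi>\<close> (\<open>mat_apply_adjoint\<close>), so \<open>\<Phi> X\<close> is a vector of \<open>M\<close> if and
  only if \<open>X\<close> is orthogonal to the pulled back rows \<open>s \<mapsto> \<Phi>\<^sub>s \<mu>(\<Phi>(s), x)\<close>, where
  \<open>\<Phi>\<^sub>s\<close> is the nonzero entry of column \<open>s\<close> and \<open>\<Phi>(s)\<close> its row.  Hence the conditions on circuits
  and on Grassmann-Pluecker functions both say that the pulled back rows are covectors of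
  \<open>N\<close>.  A morphism satisfies this because circuits are vectors.  Conversely, over a perfect
  idyll all vectors of \<open>N\<close> are orthogonal to these covectors, so that \<open>\<Phi>\<close> is a morphism.

  The condition on the preimage is a reformulation of the definition of a morphism as soon as the
  matroid \<open>\<Phi>\<^sup>-\<^sup>1(M)\<close> exists and is unique.  It is given by the function
  \<open>x \<mapsto> (\<Prod>\<^sub>i \<Phi>\<^bsub>x\<^sub>i\<^esub>) \<mu>(\<Phi>(x\<^sub>1), \<dots>, \<Phi>(x\<^sub>q), b)\<close>, where \<open>b\<close> is as short as possible such that the function is
  not zero.  Minimality removes exactly those terms of the relations of \<open>\<mu>\<close> that omit an entry
  of \<open>b\<close>, so that covectors pull back to covectors (\<open>pullback_minor_orthogonal\<close>).  The relations
  of the new function are a special case, and with perfection the same fact yields its vectors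
  (\<open>preimage_exists\<close>).

  Uniqueness holds because vectors determine a matroid (\<open>fmatroid_determined_by_vectors\<close>).  Two
  functions with the same vectors satisfy mixed Pluecker relations, since the circuits of each are
  vectors of the other.  A null sum cannot have a single nonzero term, so these relations allow
  basis exchange between the two functions, and a null sum of two terms determines their ratio.
  Thus the functions have the same rank and support and are proportional.

  Perfection is given for ground sets of natural numbers.  It transfers to all finite ground sets
  because relabelling is a pullback along a bijection.
\<close>

section \<open>Arithmetic of idylls\<close>

lemma idyll_inverse:
  fixes a :: "'f::idyll"
  assumes "a \<noteq> 0"
  obtains a' where "a' \<noteq> 0" "\<And>b. a' * (a * b) = b" "\<And>b. a * (a' * b) = b"
proof -
  obtain a' where a': "a * a' = 1"
    using unit_group[OF assms] by blast
  then have "a' * a = 1"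
    by (simp add: mult.commute)
  moreover have "a' \<noteq> 0"
    using a' by auto
  ultimately show thesis
    using that[of a'] a' by (simp flip: mult.assoc)
qed

lemma idyll_mult_eq_0_iff [simp]: "a * b = 0 \<longleftrightarrow> a = 0 \<or> b = 0" for a b :: "'f::idyll"
proof
  assume ab: "a * b = 0"
  show "a = 0 \<or> b = 0"
  proof (rule ccontr)
    assume nz: "\<not> (a = 0 \<or> b = 0)"
    then obtain a' where "a' * (a * b) = b"
      using idyll_inverse[of a] by metis
    then show False
      using ab nz by simp
  qed
qed auto

lemma idyll_mult_left_cancel: "a \<noteq> 0 \<Longrightarrow> a * b = a * c \<longleftrightarrow> b = c" for a b c :: "'f::idyll"
  by (metis idyll_inverse)

lemma idyll_prod_list_eq_0_iff: "prod_list xs = 0 \<longleftrightarrow> 0 \<in> set xs" for xs :: "'f::idyll list"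
  by (induction xs) auto

lemma nullset_scale:
  assumes "c \<noteq> 0" "A \<in> nullset"
  shows "image_mset ((*) c) A \<in> (nullset :: 'f::idyll multiset set)"
  using nullset_prod[of "{#c#}" A] assms by (simp add: formal_prod_def)

lemma nullset_singleton: "a \<noteq> 0 \<Longrightarrow> {#a#} \<notin> (nullset :: 'f::idyll multiset set)"
proof
  assume "a \<noteq> 0" and "{#a#} \<in> nullset"
  moreover obtain b where b: "b \<noteq> 0" "b * (a * 1) = 1"
    using idyll_inverse[OF \<open>a \<noteq> 0\<close>] by metis
  ultimately have "{#b * a#} \<in> nullset"
    using nullset_scale[of b "{#a#}"] by simp
  then show False
    using b nullset_one[where 'a = 'f] by simp
qed

lemma neg_one: "neg_one \<noteq> (0 :: 'f::idyll)" "{#1, neg_one :: 'f#} \<in> nullset"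
  using theI'[OF nullset_neg] unfolding neg_one_def by blast+

lemma neg_one_unique: "e \<noteq> 0 \<Longrightarrow> {#1, e#} \<in> nullset \<Longrightarrow> e = (neg_one :: 'f::idyll)"
  using nullset_neg neg_one by blast

lemma nullset_pair_iff:
  assumes "a \<noteq> 0" "b \<noteq> 0"
  shows "{#a, b#} \<in> nullset \<longleftrightarrow> b = neg_one * (a :: 'f::idyll)"
proof
  obtain a' where a': "a' \<noteq> 0" "\<And>b. a' * (a * b) = b" "\<And>b. a * (a' * b) = b"
    using idyll_inverse[OF \<open>a \<noteq> 0\<close>] by metis
  assume "{#a, b#} \<in> nullset"
  then have "{#a' * a, a' * b#} \<in> nullset"
    using nullset_scale[OF a'(1)] by fastforce
  then have "{#1, a' * b#} \<in> nullset"
    using a'(2)[of 1] by simp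
  then have "a' * b = neg_one"
    using neg_one_unique[of "a' * b"] a'(1) assms by auto
  then have "a * neg_one = b"
    using a'(3)[of b] by simp
  then show "b = neg_one * a"
    by (simp add: mult.commute)
next
  assume "b = neg_one * a"
  then show "{#a, b#} \<in> nullset"
    using nullset_scale[OF \<open>a \<noteq> 0\<close> neg_one(2)] by (simp add: mult.commute)
qed

lemma neg_one_sq [simp]: "neg_one * neg_one = (1 :: 'f::idyll)"
proof -
  have "{#neg_one, 1 :: 'f#} \<in> nullset"
    using neg_one(2) by (simp add: add_mset_commute)
  then show ?thesis
    using nullset_pair_iff[of neg_one "1 :: 'f"] neg_one by simp
qed

lemma neg_one_cancel [simp]: "neg_one * (neg_one * a) = (a :: 'f::idyll)"
  by (simp flip: mult.assoc)

lemma neg_one_power_nonzero [simp]: "neg_one ^ n \<noteq> (0 :: 'f::idyll)"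
  by (induction n) (auto simp: neg_one)

lemma neg_one_power_twice [simp]: "neg_one ^ n * neg_one ^ n = (1 :: 'f::idyll)"
  by (simp flip: power_mult_distrib)

lemma neg_one_power_cancel [simp]: "neg_one ^ n * (neg_one ^ n * a) = (a :: 'f::idyll)"
  by (simp flip: mult.assoc)

lemma idyll_sign_nonzero [simp]: "idyll_sign p \<noteq> (0 :: 'f::idyll)"
  by (simp add: idyll_sign_def neg_one)

section \<open>Formal sums\<close>

abbreviation null_sum :: "('i \<Rightarrow> 'f::idyll) \<Rightarrow> 'i set \<Rightarrow> bool" where
  "null_sum f I \<equiv> formal_sum f I \<in> nullset"

lemma formal_sum_cong: "(\<And>i. i \<in> I \<Longrightarrow> f i = g i) \<Longrightarrow> formal_sum f I = formal_sum g I"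
  unfolding formal_sum_def
  by (cases "finite I") (auto intro!: arg_cong[where f = "filter_mset _"] image_mset_cong)

lemma formal_sum_reindex:
  assumes "inj_on h I"
  shows "formal_sum f (h ` I) = formal_sum (\<lambda>i. f (h i)) I"
proof -
  have "mset_set (h ` I) = image_mset h (mset_set I)"
    using image_mset_mset_set[OF assms] by (rule sym)
  then show ?thesis
    by (simp only: formal_sum_def multiset.map_comp o_def)
qed

lemma formal_sum_restrict:
  assumes "finite I" "J \<subseteq> I" "\<And>i. i \<in> I - J \<Longrightarrow> f i = 0"
  shows "formal_sum f I = formal_sum f J"
proof -
  have I: "J \<union> (I - J) = I" "finite J" "finite (I - J)"
    using assms(1,2) finite_subset by blast+
  then have "mset_set I = mset_set J + mset_set (I - J)"
    using mset_set_Union[OF I(2,3)] by auto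
  then have "formal_sum f I = formal_sum f J + {#a \<in># image_mset f (mset_set (I - J)). a \<noteq> 0#}"
    by (simp add: formal_sum_def)
  moreover have "{#a \<in># image_mset f (mset_set (I - J)). a \<noteq> 0#} = {#}"
    using assms(3) I(3) by (auto simp: filter_mset_eq_mempty_iff)
  ultimately show ?thesis
    by simp
qed

lemma formal_sum_zero: "(\<And>i. i \<in> I \<Longrightarrow> f i = 0) \<Longrightarrow> formal_sum f I = {#}"
  by (subst formal_sum_cong[of I f "\<lambda>_. 0"]) (auto simp: formal_sum_def filter_mset_eq_mempty_iff)

lemma null_sum_zero: "(\<And>i. i \<in> I \<Longrightarrow> f i = 0) \<Longrightarrow> null_sum f I"
  by (simp add: formal_sum_zero nullset_empty)

lemma null_sum_scale:
  fixes c :: "'f::idyll"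
  assumes "c \<noteq> 0"
  shows "null_sum (\<lambda>i. c * f i) I \<longleftrightarrow> null_sum f I"
proof -
  have scale: "null_sum (\<lambda>i. d * g i) I" if "d \<noteq> 0" "null_sum g I" for d :: 'f and g
  proof -
    have "formal_sum (\<lambda>i. d * g i) I = image_mset ((*) d) (formal_sum g I)"
      using that(1) by (simp add: formal_sum_def filter_mset_image_mset multiset.map_comp o_def)
    then show ?thesis
      using nullset_scale that by metis
  qed
  obtain d where "d \<noteq> 0" "\<And>b. d * (c * b) = b"
    using idyll_inverse[OF assms] by metis
  then show ?thesis
    using scale[OF assms, of f] scale[of d "\<lambda>i. c * f i"] by auto
qed

lemma null_sum_pair:
  assumes "finite I" "i \<in> I" "j \<in> I" "i \<noteq> j" "f i \<noteq> 0"
    and "\<And>k. k \<in> I \<Longrightarrow> k \<noteq> i \<Longrightarrow> k \<noteq> j \<Longrightarrow> f k = 0"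
  shows "null_sum f I \<longleftrightarrow> f j = neg_one * f i"
proof (cases "f j = 0")
  case True
  have "formal_sum f I = formal_sum f {i}"
    by (rule formal_sum_restrict) (use assms True in auto)
  then show ?thesis
    using True assms(5) nullset_singleton[OF assms(5)] neg_one by (simp add: formal_sum_def)
next
  case False
  have "formal_sum f I = formal_sum f {i, j}"
    by (rule formal_sum_restrict) (use assms in auto)
  also have "\<dots> = {#f i, f j#}"
    using assms(4,5) False by (simp add: formal_sum_def)
  finally show ?thesis
    using nullset_pair_iff[OF assms(5) False] by simp
qed

text \<open>
  One nonzero element is never null.  This is the only input that basis exchange needs from the
  Pluecker relations.
\<close>

lemma null_sum_another_nonzero:
  assumes "null_sum f I" "finite I" "i \<in> I" "f i \<noteq> 0"
  obtains j where "j \<in> I" "j \<noteq> i" "f j \<noteq> 0"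
proof -
  have "\<exists>j\<in>I. j \<noteq> i \<and> f j \<noteq> 0"
  proof (rule ccontr)
    assume "\<not> ?thesis"
    then have "formal_sum f I = formal_sum f {i}"
      by (intro formal_sum_restrict) (use assms in auto)
    then show False
      using assms nullset_singleton[OF assms(4)] by (simp add: formal_sum_def)
  qed
  with that show thesis
    by blast
qed

section \<open>Alternating functions of lists\<close>

lemma omit_append [simp]: "omit (length u) (u @ a # v) = u @ v"
  by (simp add: omit_def)

lemma omit_0_Cons [simp]: "omit 0 (a # v) = v"
  by (simp add: omit_def)

lemma omit_Suc_Cons [simp]: "omit (Suc k) (a # v) = a # omit k v"
  by (simp add: omit_def)

lemma omit_append1: "k < length y \<Longrightarrow> omit k (y @ b) = omit k y @ b"
  by (simp add: omit_def)

lemma omit_append2: "omit (length y + k) (y @ b) = y @ omit k b"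
  by (simp add: omit_def)

lemma length_omit: "k < length y \<Longrightarrow> length (omit k y) = length y - 1"
  by (simp add: omit_def)

lemma set_omit_subset: "set (omit k y) \<subseteq> set y"
  by (auto simp: omit_def dest: in_set_takeD in_set_dropD)

lemma nth_in_set_omit:
  assumes "j < length y" "j \<noteq> k"
  shows "y ! j \<in> set (omit k y)"
proof (cases "j < k")
  case True
  then have "y ! j = take k y ! j" "j < length (take k y)"
    using assms(1) by auto
  then show ?thesis
    unfolding omit_def by (metis Un_iff nth_mem set_append)
next
  case False
  then have "y ! j = drop (Suc k) y ! (j - Suc k)" "j - Suc k < length (drop (Suc k) y)"
    using assms by auto
  then show ?thesis
    unfolding omit_def by (metis Un_iff nth_mem set_append)
qed

lemma split_at_nth:
  assumes "i < length y"
  obtains u v where "y = u @ y ! i # v" "length u = i"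
  using id_take_nth_drop[OF assms] assms by (metis length_take min.absorb4)

lemma permute_list_swap:
  "permute_list (Transposition.transpose (length u) (Suc (length u))) (u @ a # b # v) = u @ b # a # v"
proof (rule nth_equalityI)
  let ?p = "Transposition.transpose (length u) (Suc (length u))"
  fix i
  assume "i < length (permute_list ?p (u @ a # b # v))"
  then have "permute_list ?p (u @ a # b # v) ! i = (u @ a # b # v) ! ?p i"
    by (intro permute_list_nth permutes_swap_id) auto
  then show "permute_list ?p (u @ a # b # v) ! i = (u @ b # a # v) ! i"
    by (auto simp: nth_append nth_Cons Transposition.transpose_def split: nat.splits)
qed simp

lemma idyll_sign_swap_comp:
  assumes "p permutes {..<n}" "a \<noteq> b"
  shows "idyll_sign (Transposition.transpose a b \<circ> p) = neg_one * (idyll_sign p :: 'f::idyll)"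
proof -
  have "permutation p"
    using assms(1) permutation_permutes by blast
  then show ?thesis
    using assms(2)
    by (simp add: idyll_sign_def evenperm_comp permutation_swap_id evenperm_swap)
qed

text \<open>
  Carrying an entry past a block by adjacent swaps.  All signs below arise in this way, so that
  signs of general permutations need not be computed.
\<close>

lemma move_to_front:
  fixes H :: "'e list \<Rightarrow> 'f::idyll"
  assumes swap: "\<And>u a b v. mset (u @ a # b # v) = A \<Longrightarrow> H (u @ a # b # v) = neg_one * H (u @ b # a # v)"
  shows "mset (p @ u @ a # v) = A \<Longrightarrow> H (p @ u @ a # v) = neg_one ^ length u * H (p @ a # u @ v)"
proof (induction u arbitrary: p)
  case (Cons x u)
  have "H (p @ (x # u) @ a # v) = neg_one ^ length u * H (p @ x # a # u @ v)"
    using Cons.IH[of "p @ [x]"] Cons.prems by simp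
  also have "H (p @ x # a # u @ v) = neg_one * H (p @ a # x # u @ v)"
    by (rule swap) (use Cons.prems in simp)
  finally show ?case
    by (simp add: ac_simps)
qed simp

text \<open>Any rearrangement is a product of adjacent swaps; the proof carries the head to its place.\<close>

lemma swap_invariant_rearrange:
  assumes "\<And>u a b v. mset (u @ a # b # v) = A \<Longrightarrow> H (u @ a # b # v) = H (u @ b # a # v)"
    and "mset xs = A" "mset ys = A"
  shows "H xs = H ys"
  using assms
proof (induction xs arbitrary: H ys A)
  case (Cons x xs)
  have "x \<in> set ys"
    using Cons.prems(2,3) by (metis list.set_intros(1) mset_eq_setD)
  then obtain u v where ys: "ys = u @ x # v"
    by (meson split_list)
  have move: "mset (p @ x # v) = A \<Longrightarrow> H (p @ x # v) = H (x # p @ v)" for p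
  proof (induction p arbitrary: v rule: rev_induct)
    case (snoc z p)
    have "H ((p @ [z]) @ x # v) = H (p @ x # z # v)"
      using Cons.prems(1)[of p z x v] snoc.prems by simp
    also have "\<dots> = H (x # p @ z # v)"
      using snoc.IH[of "z # v"] snoc.prems by (simp add: add_mset_commute)
    finally show ?case
      by simp
  qed simp
  have "H (x # xs) = H (x # u @ v)"
  proof (rule Cons.IH[of "mset xs" "\<lambda>z. H (x # z)"])
    show "mset (u @ v) = mset xs"
      using Cons.prems(2,3) ys by (metis add_mset_remove_trivial mset.simps(2) mset_append
          union_mset_add_mset_right)
    show "H (x # p @ a # b # q) = H (x # p @ b # a # q)" if "mset (p @ a # b # q) = mset xs" for p a b q
      using Cons.prems(1)[of "x # p" a b q] Cons.prems(2) that by simp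
  qed simp
  then show ?case
    using move[of u] Cons.prems(3) ys by simp
qed simp

lemma gp_outside: "grassmann_pluecker E r \<phi> \<Longrightarrow> x \<notin> tuples E r \<Longrightarrow> \<phi> x = 0"
  by (simp add: grassmann_pluecker_def)

lemma gp_nonzeroD:
  assumes "grassmann_pluecker E r \<phi>" "\<phi> x \<noteq> 0"
  shows "length x = r" "set x \<subseteq> E" "distinct x"
  using assms unfolding grassmann_pluecker_def alternating_def tuples_def by blast+

lemma gp_permute_list:
  assumes "grassmann_pluecker E r \<phi>" "p permutes {..<length x}"
  shows "\<phi> (permute_list p x) = idyll_sign p * \<phi> x"
proof (cases "x \<in> tuples E r")
  case True
  then show ?thesis
    using assms unfolding grassmann_pluecker_def alternating_def by (auto simp: tuples_def)
next
  case False
  then have "permute_list p x \<notin> tuples E r"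
    using assms(2) by (simp add: tuples_def)
  then show ?thesis
    using False gp_outside[OF assms(1)] by simp
qed

text \<open>
  The factor is the same for all functions, so that the ratio of two Grassmann-Pluecker functions at
  a basis does not depend on the order of its elements.
\<close>

lemma gp_rearrange:
  assumes "mset xs = mset ys"
  obtains s :: "'f::idyll" where "s \<noteq> 0"
    "\<And>E r \<phi>. grassmann_pluecker E r \<phi> \<Longrightarrow> \<phi> xs = s * \<phi> ys"
proof -
  obtain p where p: "p permutes {..<length ys}" "permute_list p ys = xs"
    using mset_eq_permutation[OF assms] by blast
  show thesis
    by (rule that[of "idyll_sign p"]) (use gp_permute_list p in fastforce)+
qed

lemma gp_swap:
  fixes \<phi> :: "'e list \<Rightarrow> 'f::idyll"
  assumes "grassmann_pluecker E r \<phi>"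
  shows "\<phi> (u @ a # b # v) = neg_one * \<phi> (u @ b # a # v)"
proof -
  let ?p = "Transposition.transpose (length u) (Suc (length u))"
  have "?p permutes {..<length (u @ b # a # v)}"
    by (rule permutes_swap_id) auto
  moreover have "idyll_sign ?p = (neg_one :: 'f)"
    by (simp add: idyll_sign_def evenperm_swap)
  ultimately show ?thesis
    using gp_permute_list[OF assms] permute_list_swap[of u b a v] by metis
qed

section \<open>Cocircuits and circuits in terms of the Grassmann-Pluecker function\<close>

lemma ground_order_linear: "linear_order_on E (ground_order E)"
proof -
  have "\<exists>R. linear_order_on E R"
    using well_order_on[of E] unfolding well_order_on_def by blast
  then show ?thesis
    unfolding ground_order_def by (rule someI_ex)
qed

lemma sorted_rearrangement_exists:
  assumes R: "linear_order_on E R" and "set z \<subseteq> E"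
  shows "\<exists>ys. mset ys = mset z \<and> sorted_wrt (\<lambda>a b. (a, b) \<in> R) ys"
  using assms(2)
proof (induction z)
  case (Cons a z)
  then obtain ys where ys: "mset ys = mset z" "sorted_wrt (\<lambda>a b. (a, b) \<in> R) ys"
    by auto
  have sub: "set ys \<subseteq> E" "a \<in> E"
    using Cons.prems mset_eq_setD[OF ys(1)] by auto
  have total: "(x, y) \<in> R \<or> (y, x) \<in> R" if "x \<in> E" "y \<in> E" for x y
    using R that unfolding order_on_defs refl_on_def total_on_def by metis
  have trans: "trans R"
    using R unfolding order_on_defs by blast
  \<comment> \<open>insert \<open>a\<close> between the elements below it and the others\<close>
  let ?ys = "filter (\<lambda>b. (b, a) \<in> R) ys @ a # filter (\<lambda>b. (b, a) \<notin> R) ys"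
  have "mset ?ys = mset (a # z)"
    using ys(1) multiset_partition[of "mset ys" "\<lambda>b. (b, a) \<in> R"] by simp
  moreover have "sorted_wrt (\<lambda>a b. (a, b) \<in> R) ?ys"
    using ys(2) sub total transD[OF trans]
    by (auto simp: sorted_wrt_append intro!: sorted_wrt_filter) blast+
  ultimately show ?case
    by blast
qed simp

lemma sorted_rearrangement_unique:
  assumes R: "linear_order_on E R" and "mset xs = mset ys"
    and "sorted_wrt (\<lambda>a b. (a, b) \<in> R) xs" "sorted_wrt (\<lambda>a b. (a, b) \<in> R) ys"
  shows "xs = ys"
  using assms(2-)
proof (induction xs arbitrary: ys)
  case (Cons a xs)
  then obtain b ys' where ys: "ys = b # ys'"
    by (cases ys) auto
  have anti: "antisym R"
    using R unfolding order_on_defs by blast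
  have "a = b"
  proof (rule ccontr)
    assume "a \<noteq> b"
    then have "a \<in> set ys'" "b \<in> set xs"
      using mset_eq_setD[OF Cons.prems(1)] ys by auto
    then have "(a, b) \<in> R" "(b, a) \<in> R"
      using Cons.prems ys by auto
    then show False
      using antisymD[OF anti] \<open>a \<noteq> b\<close> by blast
  qed
  then show ?case
    using Cons ys by simp
qed simp

lemma sorting_permutation_unique:
  assumes "distinct z" "set z \<subseteq> E"
  shows "\<exists>!p. p permutes {..<length z} \<and>
    sorted_wrt (\<lambda>a b. (a, b) \<in> ground_order E) (permute_list p z)"
    (is "\<exists>!p. ?P p")
proof (rule ex_ex1I)
  obtain ys where ys: "mset ys = mset z" "sorted_wrt (\<lambda>a b. (a, b) \<in> ground_order E) ys"
    using sorted_rearrangement_exists[OF ground_order_linear assms(2)] by blast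
  then show "\<exists>p. ?P p"
    using mset_eq_permutation[OF ys(1)] by metis
next
  fix p q
  assume p: "?P p" and q: "?P q"
  then have eq: "permute_list p z = permute_list q z"
    by (intro sorted_rearrangement_unique[OF ground_order_linear]) auto
  show "p = q"
  proof
    fix i
    show "p i = q i"
    proof (cases "i < length z")
      case True
      then have "z ! p i = z ! q i"
        using eq p q permute_list_nth by metis
      moreover have "p i < length z" "q i < length z"
        using True p q permutes_in_image by fastforce+
      ultimately show ?thesis
        using assms(1) nth_eq_iff_index_eq by blast
    next
      case False
      then show ?thesis
        using p q by (simp add: permutes_def)
    qed
  qed
qed

text \<open>The sorting permutation of one list is that of the other preceded by the transposition.\<close>

lemma sort_sign_swap:
  assumes "distinct (u @ a # b # v)" "set (u @ a # b # v) \<subseteq> E"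
  shows "sort_sign E (u @ a # b # v) = neg_one * (sort_sign E (u @ b # a # v) :: 'f::idyll)"
proof -
  let ?z = "u @ a # b # v" and ?z' = "u @ b # a # v"
  let ?t = "Transposition.transpose (length u) (Suc (length u))"
  let ?P = "\<lambda>z p. p permutes {..<length z} \<and>
    sorted_wrt (\<lambda>a b. (a, b) \<in> ground_order E) (permute_list p z)"
  have ex1: "\<exists>!p. ?P ?z p" "\<exists>!p. ?P ?z' p"
    using assms by (intro sorting_permutation_unique; auto)+
  define p where "p = (THE p. ?P ?z' p)"
  have p: "?P ?z' p"
    unfolding p_def by (rule theI'[OF ex1(2)])
  have "?t permutes {..<length ?z}"
    by (rule permutes_swap_id) auto
  moreover have "permute_list (?t \<circ> p) ?z = permute_list p ?z'"
    using p permute_list_compose[of p ?z ?t] permute_list_swap[of u a b v] by simp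
  ultimately have "?P ?z (?t \<circ> p)"
    using p permutes_compose[of p "{..<length ?z}" ?t] by simp
  then have "(THE p. ?P ?z p) = ?t \<circ> p"
    by (rule the1_equality[OF ex1(1)])
  then have "sort_sign E ?z = (idyll_sign (?t \<circ> p) :: 'f)"
    unfolding sort_sign_def by (rule arg_cong)
  moreover have "sort_sign E ?z' = (idyll_sign p :: 'f)"
    unfolding sort_sign_def p_def by (rule refl)
  moreover have "idyll_sign (?t \<circ> p) = neg_one * (idyll_sign p :: 'f)"
    using p by (intro idyll_sign_swap_comp[of p "length ?z'"]) auto
  ultimately show ?thesis
    by simp
qed

lemma sort_sign_nonzero: "sort_sign E z \<noteq> (0 :: 'f::idyll)"
  by (simp add: sort_sign_def)

lemma complement_list:
  assumes "finite E"
  shows "distinct (complement_list E x)" "set (complement_list E x) = E - set x"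
proof -
  have "\<exists>x'. distinct x' \<and> set x' = E - set x"
    using finite_distinct_list[of "E - set x"] assms by auto
  from someI_ex[OF this] show "distinct (complement_list E x)" "set (complement_list E x) = E - set x"
    unfolding complement_list_def by blast+
qed

text \<open>
  The two signs change simultaneously when the complement is listed in another order, so any
  listing of it computes the dual function.
\<close>

lemma dual_gp_eq:
  assumes "finite E" "grassmann_pluecker E r \<phi>"
    and "x \<in> tuples E (card E - r)" "distinct x" "distinct c" "set c = E - set x"
  shows "dual_gp E r \<phi> x = sort_sign E (x @ c) * \<phi> c"
proof -
  note cl = complement_list[OF assms(1), of x]
  have "sort_sign E (x @ complement_list E x) * \<phi> (complement_list E x) = sort_sign E (x @ c) * \<phi> c"
  proof (rule swap_invariant_rearrange[where A = "mset c" and H = "\<lambda>c. sort_sign E (x @ c) * \<phi> c"])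
    show "mset (complement_list E x) = mset c"
      using cl assms(5,6) by (simp add: set_eq_iff_mset_eq_distinct[symmetric])
    fix u a b v
    assume eq: "mset (u @ a # b # v) = mset c"
    have "distinct (u @ a # b # v)" "set (u @ a # b # v) = E - set x"
      using eq assms(5,6) mset_eq_imp_distinct_iff mset_eq_setD by blast+
    then have "sort_sign E ((x @ u) @ a # b # v) = neg_one * (sort_sign E ((x @ u) @ b # a # v) :: 'b)"
      using assms(3,4) by (intro sort_sign_swap) (auto simp: tuples_def)
    then show "sort_sign E (x @ u @ a # b # v) * \<phi> (u @ a # b # v) =
        sort_sign E (x @ u @ b # a # v) * \<phi> (u @ b # a # v)"
      using gp_swap[OF assms(2), of u a b v] by (simp add: ac_simps)
  qed simp
  then show ?thesis
    using assms(3,4) by (simp add: dual_gp_def)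
qed

lemma circuit_vec_nth:
  "distinct y \<Longrightarrow> i < length y \<Longrightarrow> circuit_vec \<phi> y (y ! i) = neg_one ^ i * \<phi> (omit i y)"
proof -
  assume "distinct y" "i < length y"
  then have "(THE j. j < length y \<and> y ! j = y ! i) = i"
    by (intro the_equality) (auto simp: nth_eq_iff_index_eq)
  then show ?thesis
    using \<open>i < length y\<close> by (simp add: circuit_vec_def)
qed

lemma circuit_vec_outside: "e \<notin> set y \<Longrightarrow> circuit_vec \<phi> y e = 0"
  by (simp add: circuit_vec_def)

text \<open>
  In the circuit of the dual at \<open>y\<close>, moving the omitted entry to its place costs a sign that
  cancels the sign in the circuit up to a factor independent of the entry.  What remains is the
  row of \<open>\<phi>\<close> at the complement of \<open>y\<close>.
\<close>

lemma circuit_vec_dual: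
  assumes fin: "finite E" and gp: "grassmann_pluecker E r \<phi>" and r: "r \<le> card E"
    and y: "y \<in> tuples E (Suc (card E - r))" "distinct y"
    and c: "distinct c" "set c = E - set y"
  shows "circuit_vec (dual_gp E r \<phi>) y =
    (\<lambda>e. neg_one ^ (card E - r) * sort_sign E (y @ c) * \<phi> (e # c))"
proof
  fix e
  consider "e \<in> set y" | "e \<in> set c" | "e \<notin> E"
    using c y(1) by (auto simp: tuples_def)
  then show "circuit_vec (dual_gp E r \<phi>) y e =
    neg_one ^ (card E - r) * sort_sign E (y @ c) * \<phi> (e # c)"
  proof cases
    case 1
    then obtain i where i: "i < length y" "e = y ! i"
      by (metis in_set_conv_nth)
    then obtain u v where uv: "y = u @ e # v" "length u = i"
      using split_at_nth by metis
    have len: "length u + length v = card E - r"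
      using y(1) uv by (simp add: tuples_def)
    have "sort_sign E ((u @ e # v) @ c) = (neg_one :: 'b) ^ length v * sort_sign E (u @ v @ e # c)"
    proof -
      have "sort_sign E (u @ v @ e # c) = (neg_one :: 'b) ^ length v * sort_sign E (u @ e # v @ c)"
      proof (rule move_to_front)
        fix u' a b v'
        assume eq: "mset (u' @ a # b # v') = mset (u @ v @ e # c)"
        have "distinct (u @ v @ e # c)" "set (u @ v @ e # c) \<subseteq> E"
          using y c uv by (auto simp: tuples_def)
        then show "sort_sign E (u' @ a # b # v') = neg_one * (sort_sign E (u' @ b # a # v') :: 'b)"
          using mset_eq_imp_distinct_iff[OF eq] mset_eq_setD[OF eq] by (intro sort_sign_swap) auto
      qed simp
      then show ?thesis
        by (simp flip: mult.assoc)
    qed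
    moreover have "dual_gp E r \<phi> (u @ v) = sort_sign E ((u @ v) @ e # c) * \<phi> (e # c)"
      using y c uv by (intro dual_gp_eq[OF fin gp]) (auto simp: tuples_def)
    moreover have "circuit_vec (dual_gp E r \<phi>) y e = neg_one ^ length u * dual_gp E r \<phi> (u @ v)"
      using circuit_vec_nth[OF y(2) i(1)] uv i by (metis omit_append)
    moreover have "neg_one ^ (card E - r) = (neg_one :: 'b) ^ length u * neg_one ^ length v"
      unfolding len[symmetric] by (rule power_add)
    ultimately show ?thesis
      unfolding uv(1) by (simp add: ac_simps)
  next
    case 2
    then have "\<phi> (e # c) = 0"
      using gp_nonzeroD(3)[OF gp, of "e # c"] by auto
    then show ?thesis
      using 2 c by (simp add: circuit_vec_outside)
  next
    case 3
    then have "\<phi> (e # c) = 0"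
      using gp_nonzeroD(2)[OF gp, of "e # c"] by auto
    moreover have "e \<notin> set y"
      using 3 y(1) by (auto simp: tuples_def)
    ultimately show ?thesis
      by (simp add: circuit_vec_outside)
  qed
qed

lemma gp_rank_le_card:
  assumes "finite E" "grassmann_pluecker E r \<phi>"
  shows "r \<le> card E"
proof -
  obtain x where "\<phi> x \<noteq> 0"
    using assms(2) unfolding grassmann_pluecker_def by blast
  then show ?thesis
    using gp_nonzeroD[OF assms(2)] assms(1) by (metis card_mono distinct_card)
qed

lemma circuit_vec_scale: "circuit_vec (\<lambda>x. b * \<phi> x) y = (\<lambda>e. b * circuit_vec \<phi> y e)"
  by (auto simp: circuit_vec_def Let_def ac_simps)

lemma circuits_gp_class:
  "X \<in> circuits (FMatroid E r (gp_class \<phi>)) \<longleftrightarrow>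
    (\<exists>a y. a \<noteq> 0 \<and> X = (\<lambda>e. a * circuit_vec \<phi> y e) \<and> y \<in> tuples E (Suc r) \<and> distinct y \<and>
      (\<exists>k\<le>r. \<phi> (omit k y) \<noteq> 0))"
proof
  assume "X \<in> circuits (FMatroid E r (gp_class \<phi>))"
  then obtain a b y where "a \<noteq> 0" "b \<noteq> 0" "X = (\<lambda>e. a * circuit_vec (\<lambda>x. b * \<phi> x) y e)"
    "y \<in> tuples E (Suc r)" "distinct y" "\<exists>k\<le>r. \<phi> (omit k y) \<noteq> 0"
    unfolding circuits_def gp_class_def by fastforce
  then show "\<exists>a y. a \<noteq> 0 \<and> X = (\<lambda>e. a * circuit_vec \<phi> y e) \<and> y \<in> tuples E (Suc r) \<and> distinct y \<and>
      (\<exists>k\<le>r. \<phi> (omit k y) \<noteq> 0)"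
    by (intro exI[of _ "a * b"] exI[of _ y]) (auto simp: circuit_vec_scale mult.assoc)
next
  assume "\<exists>a y. a \<noteq> 0 \<and> X = (\<lambda>e. a * circuit_vec \<phi> y e) \<and> y \<in> tuples E (Suc r) \<and> distinct y \<and>
      (\<exists>k\<le>r. \<phi> (omit k y) \<noteq> 0)"
  moreover have "\<phi> \<in> gp_class \<phi>"
    unfolding gp_class_def by (auto intro!: exI[of _ 1])
  ultimately show "X \<in> circuits (FMatroid E r (gp_class \<phi>))"
    unfolding circuits_def by auto
qed

lemma dual_gp_class: "dual_gp E r ` gp_class \<phi> = gp_class (dual_gp E r \<phi>)"
proof -
  have "dual_gp E r (\<lambda>x. a * \<phi> x) = (\<lambda>x. a * dual_gp E r \<phi> x)" for a
    by (auto simp: dual_gp_def ac_simps)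
  then show ?thesis
    unfolding gp_class_def by (auto simp: image_iff) metis
qed

text \<open>
  The row at \<open>x\<close> arises from the circuit of the dual at a listing of the complement of \<open>x\<close>, and
  every circuit of the dual arises in this way.
\<close>

lemma cocircuits_iff:
  fixes \<phi> :: "'e list \<Rightarrow> 'f::idyll"
  assumes fin: "finite E" and gp: "grassmann_pluecker E r \<phi>"
  shows "Z \<in> cocircuits (fmatroid_of E r \<phi>) \<longleftrightarrow>
    (\<exists>a x. a \<noteq> 0 \<and> set x \<subseteq> E \<and> Suc (length x) = r \<and> Z = (\<lambda>e. a * \<phi> (e # x)) \<and> (\<exists>e. \<phi> (e # x) \<noteq> 0))"
proof -
  note le = gp_rank_le_card[OF fin gp]
  have coc: "cocircuits (fmatroid_of E r \<phi>) =
      circuits (FMatroid E (card E - r) (gp_class (dual_gp E r \<phi>)))"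
    by (simp add: cocircuits_def dual_matroid_def fmatroid_of_def dual_gp_class)
  show ?thesis
  proof
    assume "Z \<in> cocircuits (fmatroid_of E r \<phi>)"
    then obtain a y k where a: "a \<noteq> 0" and Z: "Z = (\<lambda>e. a * circuit_vec (dual_gp E r \<phi>) y e)"
      and y: "y \<in> tuples E (Suc (card E - r))" "distinct y"
      and k: "k \<le> card E - r" "dual_gp E r \<phi> (omit k y) \<noteq> 0"
      unfolding coc circuits_gp_class by blast
    let ?c = "complement_list E y"
    note c = complement_list[OF fin, of y]
    have row: "circuit_vec (dual_gp E r \<phi>) y =
        (\<lambda>e. neg_one ^ (card E - r) * sort_sign E (y @ ?c) * \<phi> (e # ?c))"
      by (rule circuit_vec_dual[OF fin gp le y c])
    have "circuit_vec (dual_gp E r \<phi>) y (y ! k) \<noteq> 0"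
      using circuit_vec_nth[OF y(2), of k "dual_gp E r \<phi>"] k y(1) by (simp add: tuples_def)
    then have nz: "\<phi> (y ! k # ?c) \<noteq> 0"
      unfolding row by auto
    moreover have "Suc (length ?c) = r" "set ?c \<subseteq> E"
      using gp_nonzeroD[OF gp nz] by auto
    ultimately show "\<exists>a x. a \<noteq> 0 \<and> set x \<subseteq> E \<and> Suc (length x) = r \<and> Z = (\<lambda>e. a * \<phi> (e # x)) \<and>
        (\<exists>e. \<phi> (e # x) \<noteq> 0)"
      using a unfolding Z row
      by (intro exI[of _ "a * (neg_one ^ (card E - r) * sort_sign E (y @ ?c))"] exI[of _ ?c])
        (auto simp: sort_sign_nonzero mult.assoc)
  next
    assume "\<exists>a x. a \<noteq> 0 \<and> set x \<subseteq> E \<and> Suc (length x) = r \<and> Z = (\<lambda>e. a * \<phi> (e # x)) \<and>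
        (\<exists>e. \<phi> (e # x) \<noteq> 0)"
    then obtain a x e where a: "a \<noteq> 0" and x: "set x \<subseteq> E" "Suc (length x) = r"
      and Z: "Z = (\<lambda>e. a * \<phi> (e # x))" and nz: "\<phi> (e # x) \<noteq> 0"
      by blast
    have e: "e \<in> E" "e \<notin> set x" "distinct x"
      using gp_nonzeroD[OF gp nz] by auto
    let ?y = "complement_list E x"
    note y = complement_list[OF fin, of x]
    have "length ?y = card (E - set x)"
      using distinct_card[OF y(1)] y(2) by simp
    also have "\<dots> = card E - length x"
      using x(1) fin distinct_card[OF e(3)] by (simp add: card_Diff_subset finite_subset)
    finally have yt: "?y \<in> tuples E (Suc (card E - r))"
      using y x le by (auto simp: tuples_def)
    define s :: 'f where "s = neg_one ^ (card E - r) * sort_sign E (?y @ x)"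
    have s: "s \<noteq> 0"
      by (simp add: s_def sort_sign_nonzero)
    have row: "circuit_vec (dual_gp E r \<phi>) ?y = (\<lambda>e. s * \<phi> (e # x))"
      unfolding s_def
      by (rule circuit_vec_dual[OF fin gp le yt y(1) e(3)]) (use x y in auto)
    obtain k where k: "k < length ?y" "?y ! k = e"
      using e y(2) by (metis DiffI in_set_conv_nth)
    then have "dual_gp E r \<phi> (omit k ?y) \<noteq> 0"
      using circuit_vec_nth[OF y(1) k(1), of "dual_gp E r \<phi>"] nz s unfolding row by auto
    moreover have "k \<le> card E - r"
      using k yt by (simp add: tuples_def)
    moreover obtain t where t: "t \<noteq> 0" "\<And>b. t * (s * b) = b"
      using idyll_inverse[OF s] by metis
    ultimately show "Z \<in> cocircuits (fmatroid_of E r \<phi>)"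
      unfolding coc circuits_gp_class Z using a yt y
      by (intro exI[of _ "a * t"] exI[of _ ?y]) (auto simp: row mult.assoc)
  qed
qed

text \<open>
  If \<open>\<phi>\<close> consists of the maximal minors of a matrix then these conditions say that \<open>X\<close> is a linear
  relation between the columns of the matrix and that \<open>Z\<close> lies in its row space.  They will turn out
  to define the vectors and the covectors.
\<close>

definition row_orthogonal :: "'e set \<Rightarrow> nat \<Rightarrow> ('e list \<Rightarrow> 'f::idyll) \<Rightarrow> ('e \<Rightarrow> 'f) \<Rightarrow> bool" where
  "row_orthogonal E r \<phi> X \<longleftrightarrow>
    (\<forall>x. set x \<subseteq> E \<and> Suc (length x) = r \<longrightarrow> null_sum (\<lambda>e. X e * \<phi> (e # x)) E)"

definition minor_orthogonal :: "'e set \<Rightarrow> nat \<Rightarrow> ('e list \<Rightarrow> 'f::idyll) \<Rightarrow> ('e \<Rightarrow> 'f) \<Rightarrow> bool" where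
  "minor_orthogonal E r \<phi> Z \<longleftrightarrow>
    (\<forall>y\<in>tuples E (Suc r). null_sum (\<lambda>k. neg_one ^ k * \<phi> (omit k y) * Z (y ! k)) {..r})"

lemma row_minor_orthogonal:
  assumes "grassmann_pluecker E r \<phi>" "set x \<subseteq> E" "Suc (length x) = r"
  shows "minor_orthogonal E r \<phi> (\<lambda>e. \<phi> (e # x))"
  using assms by (simp add: grassmann_pluecker_def minor_orthogonal_def)

lemma row_orthogonal_iff_cocircuits:
  fixes \<phi> :: "'e list \<Rightarrow> 'f::idyll"
  assumes fin: "finite E" and gp: "grassmann_pluecker E r \<phi>"
  shows "(\<forall>Y\<in>cocircuits (fmatroid_of E r \<phi>). perp E X Y) \<longleftrightarrow> row_orthogonal E r \<phi> X"
proof -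
  have scale: "perp E X (\<lambda>e. a * Y e) \<longleftrightarrow> null_sum (\<lambda>e. X e * Y e) E" if "a \<noteq> 0" for a :: 'f and Y
    unfolding perp_def using null_sum_scale[OF that, of "\<lambda>e. X e * Y e" E]
    by (simp add: mult.left_commute)
  show ?thesis
  proof
    assume L: "\<forall>Y\<in>cocircuits (fmatroid_of E r \<phi>). perp E X Y"
    show "row_orthogonal E r \<phi> X"
      unfolding row_orthogonal_def
    proof (intro allI impI, elim conjE)
      fix x
      assume x: "set x \<subseteq> E" "Suc (length x) = r"
      show "null_sum (\<lambda>e. X e * \<phi> (e # x)) E"
      proof (cases "\<exists>e. \<phi> (e # x) \<noteq> 0")
        case True
        then have "(\<lambda>e. 1 * \<phi> (e # x)) \<in> cocircuits (fmatroid_of E r \<phi>)"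
          using x unfolding cocircuits_iff[OF fin gp] by (intro exI[of _ 1] exI[of _ x]) auto
        then have "perp E X (\<lambda>e. 1 * \<phi> (e # x))"
          using L by blast
        then show ?thesis
          using scale[OF one_neq_zero, of "\<lambda>e. \<phi> (e # x)"] by blast
      qed (simp add: null_sum_zero)
    qed
  next
    assume R: "row_orthogonal E r \<phi> X"
    show "\<forall>Y\<in>cocircuits (fmatroid_of E r \<phi>). perp E X Y"
    proof
      fix Y
      assume "Y \<in> cocircuits (fmatroid_of E r \<phi>)"
      then obtain a x where a: "a \<noteq> 0" and x: "set x \<subseteq> E" "Suc (length x) = r"
        and Y: "Y = (\<lambda>e. a * \<phi> (e # x))"
        unfolding cocircuits_iff[OF fin gp] by blast
      have "null_sum (\<lambda>e. X e * \<phi> (e # x)) E"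
        using R x unfolding row_orthogonal_def by simp
      then show "perp E X Y"
        unfolding Y using scale[OF a, of "\<lambda>e. \<phi> (e # x)"] by blast
    qed
  qed
qed

lemma vectors_iff:
  assumes "finite E" "grassmann_pluecker E r \<phi>"
  shows "X \<in> vectors (fmatroid_of E r \<phi>) \<longleftrightarrow> X \<in> vecs E \<and> row_orthogonal E r \<phi> X"
  using row_orthogonal_iff_cocircuits[OF assms, of X]
  by (simp add: vectors_def fmatroid_of_def)

lemma formal_sum_circuit_vec:
  assumes "finite E" "y \<in> tuples E (Suc r)" "distinct y"
  shows "formal_sum (\<lambda>e. circuit_vec \<phi> y e * Z e) E =
    formal_sum (\<lambda>k. neg_one ^ k * \<phi> (omit k y) * Z (y ! k)) {..r}"
proof -
  have y: "length y = Suc r" "set y \<subseteq> E"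
    using assms(2) by (auto simp: tuples_def)
  have img: "(!) y ` {..r} = set y"
    using y(1) by (auto simp: in_set_conv_nth image_iff less_Suc_eq_le)
  have "formal_sum (\<lambda>e. circuit_vec \<phi> y e * Z e) E = formal_sum (\<lambda>e. circuit_vec \<phi> y e * Z e) (set y)"
    by (rule formal_sum_restrict) (use assms(1) y in \<open>auto simp: circuit_vec_outside\<close>)
  also have "\<dots> = formal_sum (\<lambda>k. circuit_vec \<phi> y (y ! k) * Z (y ! k)) {..r}"
    unfolding img[symmetric]
    by (rule formal_sum_reindex) (use assms(3) y in \<open>auto simp: inj_on_def nth_eq_iff_index_eq\<close>)
  also have "\<dots> = formal_sum (\<lambda>k. neg_one ^ k * \<phi> (omit k y) * Z (y ! k)) {..r}"
    by (rule formal_sum_cong) (use assms(3) y in \<open>auto simp: circuit_vec_nth\<close>)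
  finally show ?thesis .
qed

text \<open>
  If a tuple repeats an entry then only the two minors omitting one of the two copies survive, and
  these minors differ by the sign of moving one copy to the place of the other.
\<close>

lemma minor_sum_nondistinct:
  fixes \<phi> :: "'e list \<Rightarrow> 'f::idyll"
  assumes gp: "grassmann_pluecker E r \<phi>" and len: "length y = Suc r" and nd: "\<not> distinct y"
  shows "null_sum (\<lambda>k. neg_one ^ k * \<phi> (omit k y) * Z (y ! k)) {..r}"
proof -
  obtain u v w a where y: "y = u @ [a] @ v @ [a] @ w"
    using not_distinct_decomp[OF nd] by blast
  let ?f = "\<lambda>k. neg_one ^ k * \<phi> (omit k y) * Z (y ! k)"
  let ?i = "length u" and ?j = "Suc (length u + length v)"
  have oi: "omit ?i y = u @ v @ a # w"
    using omit_append[of u a "v @ a # w"] y by simp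
  have oj: "omit ?j y = u @ a # v @ w"
    using omit_append[of "u @ a # v" a w] y by simp
  have yi: "y ! ?i = a" and yj: "y ! ?j = a"
    unfolding y by (simp_all add: nth_append)
  have move: "\<phi> (u @ v @ a # w) = neg_one ^ length v * \<phi> (u @ a # v @ w)"
    by (rule move_to_front[where A = "mset (u @ v @ a # w)"]) (rule gp_swap[OF gp], rule refl)
  have fj: "?f ?j = neg_one * ?f ?i"
    unfolding oi oj yi yj move by (simp add: power_add ac_simps)
  have others: "?f k = 0" if k: "k \<in> {..r}" "k \<noteq> ?i" "k \<noteq> ?j" for k
  proof -
    have "\<not> distinct (omit k y)"
    proof -
      consider "k < ?i" | "?i < k" "k < ?j" | "?j < k"
        using k by linarith
      then show ?thesis
      proof cases
        case 1
        then have "omit k y = omit k u @ [a] @ v @ [a] @ w"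
          unfolding y omit_def by simp
        then show ?thesis
          by simp
      next
        case 2
        define m where "m = k - Suc ?i"
        have m: "k = length (u @ [a]) + m" "m < length v"
          using 2 by (auto simp: m_def)
        then have "omit k y = omit (length (u @ [a]) + m) ((u @ [a]) @ v @ [a] @ w)"
          by (simp add: y)
        then show ?thesis
          unfolding omit_append2 omit_append1[OF m(2)] by simp
      next
        case 3
        define m where "m = k - Suc ?j"
        have "k = length (u @ [a] @ v @ [a]) + m"
          using 3 by (simp add: m_def)
        then have "omit k y = omit (length (u @ [a] @ v @ [a]) + m) ((u @ [a] @ v @ [a]) @ w)"
          by (simp add: y)
        then show ?thesis
          unfolding omit_append2 by simp
      qed
    qed
    then show ?thesis
      using gp_nonzeroD(3)[OF gp] by auto
  qed
  show ?thesis
  proof (cases "?f ?i = 0")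
    case True
    then have "?f ?j = 0"
      using fj by simp
    then show ?thesis
      using True others by (intro null_sum_zero) blast
  next
    case False
    have "?i \<in> {..r}" "?j \<in> {..r}"
      using len y by auto
    then show ?thesis
      using null_sum_pair[of "{..r}" ?i ?j ?f] False others fj by auto
  qed
qed

lemma minor_orthogonal_iff_circuits:
  fixes \<phi> :: "'e list \<Rightarrow> 'f::idyll"
  assumes fin: "finite E" and gp: "grassmann_pluecker E r \<phi>"
  shows "(\<forall>X\<in>circuits (fmatroid_of E r \<phi>). perp E X Z) \<longleftrightarrow> minor_orthogonal E r \<phi> Z"
proof -
  have scale: "perp E (\<lambda>e. a * circuit_vec \<phi> y e) Z \<longleftrightarrow>
      null_sum (\<lambda>k. neg_one ^ k * \<phi> (omit k y) * Z (y ! k)) {..r}"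
    if "a \<noteq> 0" "y \<in> tuples E (Suc r)" "distinct y" for a y
    unfolding perp_def mult.assoc[of a] null_sum_scale[OF that(1)]
    using formal_sum_circuit_vec[OF fin that(2,3), of \<phi> Z] by simp
  show ?thesis
  proof
    assume L: "\<forall>X\<in>circuits (fmatroid_of E r \<phi>). perp E X Z"
    show "minor_orthogonal E r \<phi> Z"
      unfolding minor_orthogonal_def
    proof
      fix y
      assume y: "y \<in> tuples E (Suc r)"
      consider "\<not> distinct y" | "\<forall>k\<le>r. \<phi> (omit k y) = 0" | "distinct y" "\<exists>k\<le>r. \<phi> (omit k y) \<noteq> 0"
        by blast
      then show "null_sum (\<lambda>k. neg_one ^ k * \<phi> (omit k y) * Z (y ! k)) {..r}"
      proof cases
        case 1
        then show ?thesis
          using minor_sum_nondistinct[OF gp] y by (simp add: tuples_def)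
      next
        case 2
        then show ?thesis
          by (intro null_sum_zero) simp
      next
        case 3
        then have "(\<lambda>e. 1 * circuit_vec \<phi> y e) \<in> circuits (fmatroid_of E r \<phi>)"
          unfolding fmatroid_of_def circuits_gp_class using y
          by (intro exI[of _ 1] exI[of _ y]) auto
        then have "perp E (\<lambda>e. 1 * circuit_vec \<phi> y e) Z"
          using L by blast
        then show ?thesis
          using scale[of 1 y] y 3 by simp
      qed
    qed
  next
    assume R: "minor_orthogonal E r \<phi> Z"
    show "\<forall>X\<in>circuits (fmatroid_of E r \<phi>). perp E X Z"
    proof
      fix X
      assume "X \<in> circuits (fmatroid_of E r \<phi>)"
      then obtain a y where a: "a \<noteq> 0" and y: "y \<in> tuples E (Suc r)" "distinct y"
        and X: "X = (\<lambda>e. a * circuit_vec \<phi> y e)"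
        unfolding fmatroid_of_def circuits_gp_class by blast
      then show "perp E X Z"
        using R y(1) unfolding X scale[OF a y] minor_orthogonal_def by simp
    qed
  qed
qed

lemma covectors_iff:
  assumes "finite E" "grassmann_pluecker E r \<phi>"
  shows "Z \<in> covectors (fmatroid_of E r \<phi>) \<longleftrightarrow> Z \<in> vecs E \<and> minor_orthogonal E r \<phi> Z"
proof -
  have "perp E Z X \<longleftrightarrow> perp E X Z" for X
    unfolding perp_def by (simp add: mult.commute)
  then show ?thesis
    using minor_orthogonal_iff_circuits[OF assms, of Z]
    by (simp add: covectors_def fmatroid_of_def)
qed

text \<open>Orthogonality of circuits and cocircuits is precisely the Pluecker relations.\<close>

lemma circuits_subset_vectors:
  fixes \<phi> :: "'e list \<Rightarrow> 'f::idyll"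
  assumes fin: "finite E" and gp: "grassmann_pluecker E r \<phi>"
  shows "circuits (fmatroid_of E r \<phi>) \<subseteq> vectors (fmatroid_of E r \<phi>)"
proof
  fix X
  assume X: "X \<in> circuits (fmatroid_of E r \<phi>)"
  then have "X \<in> vecs E"
    unfolding fmatroid_of_def circuits_gp_class vecs_def tuples_def
    by (auto intro!: circuit_vec_outside)
  moreover have "row_orthogonal E r \<phi> X"
    unfolding row_orthogonal_def
  proof (intro allI impI, elim conjE)
    fix x
    assume "set x \<subseteq> E" "Suc (length x) = r"
    then have "perp E X (\<lambda>e. \<phi> (e # x))"
      using minor_orthogonal_iff_circuits[OF fin gp, of "\<lambda>e. \<phi> (e # x)"]
        row_minor_orthogonal[OF gp] X by blast
    then show "null_sum (\<lambda>e. X e * \<phi> (e # x)) E"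
      by (simp add: perp_def)
  qed
  ultimately show "X \<in> vectors (fmatroid_of E r \<phi>)"
    using vectors_iff[OF fin gp] by blast
qed

section \<open>Pulling back a matroid\<close>

text \<open>
  Weight 0 makes an element a loop.  The list \<open>b\<close> fills up the tuple when the image of \<open>h\<close> does not
  span, and it will be chosen of minimal length; then the result is the restriction of the matroid
  of \<open>\<mu>\<close> to the image of \<open>h\<close>, relabelled along \<open>h\<close> and rescaled by \<open>c\<close>.
\<close>

definition pullback_gp ::
    "'s set \<Rightarrow> ('s \<Rightarrow> 'f::idyll) \<Rightarrow> ('s \<Rightarrow> 't) \<Rightarrow> 't list \<Rightarrow> ('t list \<Rightarrow> 'f) \<Rightarrow> 's list \<Rightarrow> 'f" where
  "pullback_gp S c h b \<mu> x = (if set x \<subseteq> S then prod_list (map c x) * \<mu> (map h x @ b) else 0)"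

lemma prod_list_omit:
  "k < length y \<Longrightarrow> prod_list (map c y) = prod_list (map c (omit k y)) * c (y ! k)"
  for c :: "'s \<Rightarrow> 'f::idyll"
proof -
  assume "k < length y"
  then obtain u v where "y = u @ y ! k # v" "length u = k"
    using split_at_nth by metis
  then have "prod_list (map c y) = prod_list (map c (u @ y ! k # v))" "omit k y = u @ v"
    using omit_append[of u "y ! k" v] by simp_all
  then show ?thesis
    by (simp add: ac_simps)
qed

lemma omit_map: "omit k (map h y) = map h (omit k y)"
  by (simp add: omit_def take_map drop_map)

context
  fixes S :: "'s set" and T :: "'t set" and \<mu> :: "'t list \<Rightarrow> 'f::idyll"
    and c :: "'s \<Rightarrow> 'f" and h :: "'s \<Rightarrow> 't" and b :: "'t list" and r q :: nat
  assumes gp: "grassmann_pluecker T r \<mu>"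
    and h_in: "\<And>s. s \<in> S \<Longrightarrow> c s \<noteq> 0 \<Longrightarrow> h s \<in> T"
    and b_subset: "set b \<subseteq> T" and rank: "q + length b = r"
    and shorter: "\<And>b' x. set b' \<subseteq> T \<Longrightarrow> length b' < length b \<Longrightarrow> pullback_gp S c h b' \<mu> x = 0"
begin

text \<open>
  If no entry of \<open>y\<close> has weight 0 then the relation for \<open>y\<close> is a multiple of the relation for
  \<open>map h y @ b\<close>.  The latter has additional terms, which omit an entry of \<open>b\<close>, but these vanish as \<open>b\<close> has minimal length.
\<close>

lemma pullback_minor_orthogonal:
  assumes Z: "minor_orthogonal T r \<mu> Z"
  shows "minor_orthogonal S q (pullback_gp S c h b \<mu>) (\<lambda>s. c s * Z (h s))"
  unfolding minor_orthogonal_def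
proof
  fix y
  assume "y \<in> tuples S (Suc q)"
  then have y: "length y = Suc q" "set y \<subseteq> S"
    by (auto simp: tuples_def)
  let ?f = "\<lambda>k. neg_one ^ k * pullback_gp S c h b \<mu> (omit k y) * (c (y ! k) * Z (h (y ! k)))"
  show "null_sum ?f {..q}"
  proof (cases "\<exists>s\<in>set y. c s = 0")
    case True
    then obtain j where j: "j < length y" "c (y ! j) = 0"
      by (metis in_set_conv_nth)
    have "?f k = 0" for k
    proof (cases "k = j")
      case False
      then have "0 \<in> set (map c (omit k y))"
        using nth_in_set_omit[of j y k] j by (metis image_eqI set_map)
      then have "prod_list (map c (omit k y)) = 0"
        using idyll_prod_list_eq_0_iff by blast
      then show ?thesis
        by (simp add: pullback_gp_def)
    qed (simp add: j)
    then show ?thesis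
      by (intro null_sum_zero) blast
  next
    case False
    let ?C = "prod_list (map c y)"
    have C: "?C \<noteq> 0"
      using False by (auto simp: idyll_prod_list_eq_0_iff)
    let ?Y = "map h y @ b"
    let ?g = "\<lambda>k. neg_one ^ k * \<mu> (omit k ?Y) * Z (?Y ! k)"
    have "?Y \<in> tuples T (Suc r)"
      using h_in False y b_subset rank by (auto simp: tuples_def)
    then have "null_sum ?g {..r}"
      using Z unfolding minor_orthogonal_def by blast
    moreover have "?g k = 0" if "k \<in> {..r} - {..q}" for k
    proof -
      define i where "i = k - Suc q"
      have i: "k = length (map h y) + i" "i < length b"
        using that y(1) rank by (auto simp: i_def)
      have "set (omit i b) \<subseteq> T"
        using set_omit_subset[of i b] b_subset by blast
      moreover have "length (omit i b) < length b"
        using i(2) by (simp add: length_omit)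
      ultimately have "pullback_gp S c h (omit i b) \<mu> y = 0"
        by (rule shorter)
      then have "\<mu> (map h y @ omit i b) = 0"
        using C y(2) by (simp add: pullback_gp_def)
      then show ?thesis
        unfolding i(1) omit_append2 by simp
    qed
    ultimately have "null_sum ?g {..q}"
      using formal_sum_restrict[of "{..r}" "{..q}" ?g] rank by auto
    then have "null_sum (\<lambda>k. ?C * ?g k) {..q}"
      by (simp only: null_sum_scale[OF C])
    moreover have "?C * ?g k = ?f k" if "k \<in> {..q}" for k
    proof -
      have k: "k < length y"
        using that y(1) by simp
      then have "omit k ?Y = map h (omit k y) @ b" "?Y ! k = h (y ! k)"
        by (simp_all add: omit_append1 omit_map nth_append)
      moreover have "set (omit k y) \<subseteq> S"
        by (rule order_trans[OF set_omit_subset y(2)])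
      then have "pullback_gp S c h b \<mu> (omit k y) =
          prod_list (map c (omit k y)) * \<mu> (map h (omit k y) @ b)"
        by (simp add: pullback_gp_def)
      ultimately show ?thesis
        unfolding prod_list_omit[OF k, of c] by (simp only: mult_ac)
    qed
    then have "formal_sum (\<lambda>k. ?C * ?g k) {..q} = formal_sum ?f {..q}"
      by (rule formal_sum_cong)
    ultimately show ?thesis
      by simp
  qed
qed

lemma pullback_row:
  assumes "set x \<subseteq> S" "s \<in> S"
  shows "pullback_gp S c h b \<mu> (s # x) =
    prod_list (map c x) * (c s * \<mu> (h s # map h x @ b))"
  using assms by (simp add: pullback_gp_def ac_simps)

lemma pullback_row_tuple:
  assumes "set x \<subseteq> S" "Suc (length x) = q" "prod_list (map c x) \<noteq> 0"
  shows "set (map h x @ b) \<subseteq> T" "Suc (length (map h x @ b)) = r"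
proof -
  have "c s \<noteq> 0" if "s \<in> set x" for s
    using assms(3) that by (force simp: idyll_prod_list_eq_0_iff)
  then show "set (map h x @ b) \<subseteq> T"
    using assms(1) h_in b_subset by auto
  show "Suc (length (map h x @ b)) = r"
    using assms(2) rank by simp
qed

text \<open>Each row of the pullback is a multiple of a pulled back row of \<open>\<mu>\<close>.\<close>

lemma pullback_row_orthogonal:
  assumes V: "\<And>x. set x \<subseteq> T \<Longrightarrow> Suc (length x) = r \<Longrightarrow> null_sum (\<lambda>s. V s * (c s * \<mu> (h s # x))) S"
  shows "row_orthogonal S q (pullback_gp S c h b \<mu>) V"
  unfolding row_orthogonal_def
proof (intro allI impI, elim conjE)
  fix x
  assume x: "set x \<subseteq> S" "Suc (length x) = q"
  let ?C = "prod_list (map c x)"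
  have eq: "formal_sum (\<lambda>s. V s * pullback_gp S c h b \<mu> (s # x)) S =
      formal_sum (\<lambda>s. ?C * (V s * (c s * \<mu> (h s # map h x @ b)))) S"
    by (rule formal_sum_cong) (simp add: pullback_row[OF x(1)] ac_simps)
  show "null_sum (\<lambda>s. V s * pullback_gp S c h b \<mu> (s # x)) S"
  proof (cases "?C = 0")
    case True
    then show ?thesis
      unfolding eq by (intro null_sum_zero) simp
  next
    case False
    then show ?thesis
      unfolding eq null_sum_scale[OF False] using V pullback_row_tuple x by blast
  qed
qed

text \<open>A permutation of \<open>{..<q}\<close> acts on \<open>map h x @ b\<close> as well, and it fixes the part \<open>b\<close>.\<close>

lemma pullback_alternating: "alternating S q (pullback_gp S c h b \<mu>)"
  unfolding alternating_def
proof (intro conjI ballI allI impI)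
  fix x p
  assume "x \<in> tuples S q" and p: "p permutes {..<q}"
  then have x: "length x = q" "set x \<subseteq> S"
    by (auto simp: tuples_def)
  have px: "p permutes {..<length x}"
    using p x by simp
  have pY: "p permutes {..<length (map h x @ b)}"
    by (rule permutes_subset[OF p]) (use x in auto)
  have "permute_list p (map h x @ b) = map h (permute_list p x) @ b"
  proof (rule nth_equalityI)
    fix i
    assume "i < length (permute_list p (map h x @ b))"
    then have i: "i < length (map h x @ b)"
      by simp
    have "p i < length x" if "i < length x"
      using permutes_in_image[OF px, of i] that by simp
    moreover have "p i = i" if "\<not> i < length x"
      using permutes_not_in[OF px, of i] that by simp
    ultimately show "permute_list p (map h x @ b) ! i = (map h (permute_list p x) @ b) ! i"
      unfolding permute_list_nth[OF pY i] by (auto simp: nth_append permute_list_nth[OF px])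
  qed simp
  then have "\<mu> (map h (permute_list p x) @ b) = idyll_sign p * \<mu> (map h x @ b)"
    using gp_permute_list[OF gp pY] by simp
  moreover have "prod_list (map c (permute_list p x)) = prod_list (map c x)"
    using px by (simp flip: prod_mset_prod_list)
  ultimately show "pullback_gp S c h b \<mu> (permute_list p x) = idyll_sign p * pullback_gp S c h b \<mu> x"
    using px by (simp add: pullback_gp_def ac_simps)
next
  fix x :: "'s list"
  assume "\<not> distinct x"
  then have "\<not> distinct (map h x @ b)"
    by (auto simp: distinct_map)
  then have "\<mu> (map h x @ b) = 0"
    using gp_nonzeroD(3)[OF gp] by blast
  then show "pullback_gp S c h b \<mu> x = 0"
    by (simp add: pullback_gp_def)
qed

text \<open>
  The rows of \<open>\<mu>\<close> satisfy the relations of covectors, and the rows of the pullback are multiples of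
  pulled back rows.
\<close>

lemma pullback_grassmann_pluecker:
  assumes nonzero: "\<exists>x. pullback_gp S c h b \<mu> x \<noteq> 0"
  shows "grassmann_pluecker S q (pullback_gp S c h b \<mu>)"
  unfolding grassmann_pluecker_def
proof (intro conjI allI impI, goal_cases)
  show outside: "pullback_gp S c h b \<mu> x = 0" if "x \<notin> tuples S q" for x
  proof (rule ccontr)
    assume nz: "pullback_gp S c h b \<mu> x \<noteq> 0"
    then have "set x \<subseteq> S" "\<mu> (map h x @ b) \<noteq> 0"
      by (auto simp: pullback_gp_def split: if_splits)
    then show False
      using that gp_nonzeroD(1)[OF gp, of "map h x @ b"] rank by (auto simp: tuples_def)
  qed
  show "\<exists>x\<in>tuples S q. pullback_gp S c h b \<mu> x \<noteq> 0"
    using nonzero outside by blast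
  show "alternating S q (pullback_gp S c h b \<mu>)"
    by (rule pullback_alternating)
  fix x y
  assume xy: "set x \<subseteq> S \<and> Suc (length x) = q \<and> y \<in> tuples S (Suc q)"
  let ?C = "prod_list (map c x)" and ?Z = "\<lambda>t. \<mu> (t # map h x @ b)"
  let ?f = "\<lambda>k. neg_one ^ k * pullback_gp S c h b \<mu> (omit k y)"
  have eq: "formal_sum (\<lambda>k. ?f k * pullback_gp S c h b \<mu> (y ! k # x)) {..q} =
      formal_sum (\<lambda>k. ?C * (?f k * (c (y ! k) * ?Z (h (y ! k))))) {..q}"
  proof (rule formal_sum_cong)
    fix k
    assume "k \<in> {..q}"
    then have "y ! k \<in> S"
      using xy by (auto simp: tuples_def)
    then show "?f k * pullback_gp S c h b \<mu> (y ! k # x) =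
        ?C * (?f k * (c (y ! k) * ?Z (h (y ! k))))"
      using pullback_row[of x "y ! k"] xy by (simp add: ac_simps)
  qed
  show "null_sum (\<lambda>k. ?f k * pullback_gp S c h b \<mu> (y ! k # x)) {..q}"
  proof (cases "?C = 0")
    case True
    then show ?thesis
      unfolding eq by (intro null_sum_zero) simp
  next
    case False
    have "minor_orthogonal T r \<mu> ?Z"
      using row_minor_orthogonal[OF gp] pullback_row_tuple xy False by blast
    then have "minor_orthogonal S q (pullback_gp S c h b \<mu>) (\<lambda>s. c s * ?Z (h s))"
      by (rule pullback_minor_orthogonal)
    then show ?thesis
      unfolding eq null_sum_scale[OF False] using xy unfolding minor_orthogonal_def by blast
  qed
qed

end

section \<open>Perfection for all finite ground sets\<close>

text \<open>
  Relabelling is a pullback along a bijection with weights 1, and both kinds of orthogonality are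
  pulled back.
\<close>

lemma perfect_orthogonal:
  fixes \<phi> :: "'e list \<Rightarrow> 'f::idyll"
  assumes perf: "perfect_idyll TYPE('f)" and fin: "finite E" and gp: "grassmann_pluecker E r \<phi>"
    and X: "row_orthogonal E r \<phi> X" and Z: "minor_orthogonal E r \<phi> Z"
  shows "null_sum (\<lambda>e. X e * Z e) E"
proof -
  obtain g where g: "bij_betw g {..<card E} E"
    using fin ex_bij_betw_nat_finite[of E] by (auto simp: atLeast0LessThan)
  let ?S = "{..<card E}"
  let ?\<psi> = "pullback_gp ?S (\<lambda>_. 1) g [] \<phi>"
  \<comment> \<open>elements of \<open>F\<^sup>S\<close> have to vanish outside \<open>S\<close>\<close>
  let ?X = "\<lambda>i. if i \<in> ?S then X (g i) else 0" and ?Z = "\<lambda>i. if i \<in> ?S then Z (g i) else 0"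
  have inj: "inj_on g ?S" and img: "g ` ?S = E"
    using g by (auto simp: bij_betw_def)

  have transport: "formal_sum f E = formal_sum (\<lambda>i. f (g i)) ?S" for f :: "'e \<Rightarrow> 'f"
    using formal_sum_reindex[OF inj, of f] img by simp
  obtain x where x: "\<phi> x \<noteq> 0"
    using gp unfolding grassmann_pluecker_def by blast
  have "g (inv_into ?S g e) = e" if "e \<in> set x" for e
    using that gp_nonzeroD(2)[OF gp x] img by (intro f_inv_into_f) blast
  then have "map g (map (inv_into ?S g) x) = x"
    by (simp add: map_idI)
  moreover have "set (map (inv_into ?S g) x) \<subseteq> ?S"
    using gp_nonzeroD(2)[OF gp x] img inv_into_into[of _ g ?S] by auto
  ultimately have "?\<psi> (map (inv_into ?S g) x) \<noteq> 0"
    using x by (auto simp: pullback_gp_def idyll_prod_list_eq_0_iff)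
  then have \<psi>: "grassmann_pluecker ?S r ?\<psi>"
    by (intro pullback_grassmann_pluecker[OF gp]) (use img in auto)
  have "row_orthogonal ?S r ?\<psi> ?X"
  proof (rule pullback_row_orthogonal[OF gp])
    fix x
    assume "set x \<subseteq> E" "Suc (length x) = r"
    then have "null_sum (\<lambda>e. X e * \<phi> (e # x)) E"
      using X unfolding row_orthogonal_def by blast
    then show "null_sum (\<lambda>i. ?X i * (1 * \<phi> (g i # x))) ?S"
      unfolding transport
      using formal_sum_cong[of ?S "\<lambda>i. X (g i) * \<phi> (g i # x)" "\<lambda>i. ?X i * (1 * \<phi> (g i # x))"]
      by simp
  qed (use img in auto)
  moreover have "minor_orthogonal ?S r ?\<psi> (\<lambda>i. 1 * Z (g i))"
    by (rule pullback_minor_orthogonal[OF gp _ _ _ _ Z]) (use img in auto)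
  then have "minor_orthogonal ?S r ?\<psi> ?Z"
    unfolding minor_orthogonal_def
  proof (intro ballI, goal_cases)
    case (1 y)
    then have eq: "formal_sum (\<lambda>k. neg_one ^ k * ?\<psi> (omit k y) * ?Z (y ! k)) {..r} =
        formal_sum (\<lambda>k. neg_one ^ k * ?\<psi> (omit k y) * (1 * Z (g (y ! k)))) {..r}"
      by (intro formal_sum_cong) (auto simp: tuples_def subset_iff)
    show ?case
      unfolding eq using 1 by blast
  qed
  ultimately have "?X \<in> vectors (fmatroid_of ?S r ?\<psi>)" "?Z \<in> covectors (fmatroid_of ?S r ?\<psi>)"
    using vectors_iff[OF _ \<psi>] covectors_iff[OF _ \<psi>] by (auto simp: vecs_def)
  moreover have "is_fmatroid (fmatroid_of ?S r ?\<psi>)"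
    using \<psi> unfolding is_fmatroid_def by blast
  ultimately have "perp ?S ?X ?Z"
    using perf unfolding perfect_idyll_def perp_sets_def by (fastforce simp: fmatroid_of_def)
  then have "null_sum (\<lambda>i. X (g i) * Z (g i)) ?S"
    unfolding perp_def
    using formal_sum_cong[of ?S "\<lambda>i. X (g i) * Z (g i)" "\<lambda>i. ?X i * ?Z i"] by simp
  then show ?thesis
    unfolding transport .
qed

section \<open>A matroid is determined by its vectors\<close>

text \<open>
  Exchange between two functions, possibly of different ranks, whose circuits and cocircuits are
  orthogonal: the term of \<open>a\<close> in the relation for \<open>a # b\<close> is nonzero, so there is another one.
\<close>

lemma exchange:
  fixes \<phi> \<psi> :: "'e list \<Rightarrow> 'f::idyll"
  assumes \<phi>: "grassmann_pluecker E r \<phi>" and \<psi>: "grassmann_pluecker E r' \<psi>"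
    and cross: "\<And>x. set x \<subseteq> E \<Longrightarrow> Suc (length x) = r' \<Longrightarrow> minor_orthogonal E r \<phi> (\<lambda>e. \<psi> (e # x))"
    and b: "\<phi> b \<noteq> 0" and d: "\<psi> d \<noteq> 0" and a: "a \<in> set d" "a \<notin> set b"
  obtains x e where "mset d = mset (a # x)" "\<psi> (a # x) \<noteq> 0" "e \<in> set b" "\<psi> (e # x) \<noteq> 0"
    "card (set (e # x) - set b) < card (set d - set b)"
proof -
  obtain u v where uv: "d = u @ a # v"
    using a(1) by (meson split_list)
  define x where "x = u @ v"
  have mset: "mset d = mset (a # x)"
    by (simp add: uv x_def)
  obtain s :: 'f where s: "s \<noteq> 0" "\<And>E r \<phi>. grassmann_pluecker E r \<phi> \<Longrightarrow> \<phi> d = s * \<phi> (a # x)"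
    using gp_rearrange[OF mset] by metis
  have ax: "\<psi> (a # x) \<noteq> 0"
    using d s(2)[OF \<psi>] by auto
  have x: "set x \<subseteq> E" "Suc (length x) = r'" "a \<in> E" "a \<notin> set x"
    using gp_nonzeroD[OF \<psi> ax] by auto
  have "a # b \<in> tuples E (Suc r)"
    using gp_nonzeroD[OF \<phi> b] x(3) by (simp add: tuples_def)
  then have "null_sum (\<lambda>k. neg_one ^ k * \<phi> (omit k (a # b)) * \<psi> ((a # b) ! k # x)) {..r}"
    using cross[OF x(1,2)] unfolding minor_orthogonal_def by blast
  moreover have "neg_one ^ 0 * \<phi> (omit 0 (a # b)) * \<psi> ((a # b) ! 0 # x) \<noteq> 0"
    using b ax by simp
  ultimately obtain k where k: "k \<in> {..r}" "k \<noteq> 0" "\<psi> ((a # b) ! k # x) \<noteq> 0"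
    using null_sum_another_nonzero[of "\<lambda>k. neg_one ^ k * \<phi> (omit k (a # b)) * \<psi> ((a # b) ! k # x)" "{..r}" 0]
    by auto
  define e where "e = b ! (k - 1)"
  have e: "e \<in> set b" "\<psi> (e # x) \<noteq> 0"
    using k gp_nonzeroD(1)[OF \<phi> b] by (auto simp: e_def nth_Cons' intro!: nth_mem)
  have "set (e # x) - set b \<subset> set d - set b"
    using e(1) a x(4) by (auto simp: uv x_def)
  then have "card (set (e # x) - set b) < card (set d - set b)"
    by (intro psubset_card_mono) auto
  then show thesis
    using that mset ax e by blast
qed

text \<open>
  A basis \<open>d\<close> of the second matroid with as few elements as possible outside \<open>b\<close> lies inside \<open>b\<close>, as
  exchange would bring it closer otherwise.
\<close>

lemma orthogonal_support:
  fixes \<phi> \<psi> :: "'e list \<Rightarrow> 'f::idyll"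
  assumes \<phi>: "grassmann_pluecker E r \<phi>" and \<psi>: "grassmann_pluecker E r' \<psi>"
    and cross: "\<And>x. set x \<subseteq> E \<Longrightarrow> Suc (length x) = r' \<Longrightarrow> minor_orthogonal E r \<phi> (\<lambda>e. \<psi> (e # x))"
    and b: "\<phi> b \<noteq> 0"
  shows "r' \<le> r \<and> (r = r' \<longrightarrow> \<psi> b \<noteq> 0)"
proof -
  have "\<exists>d. \<psi> d \<noteq> 0"
    using \<psi> unfolding grassmann_pluecker_def by blast
  then obtain d where d: "\<psi> d \<noteq> 0"
    and least: "\<And>d'. \<psi> d' \<noteq> 0 \<Longrightarrow> card (set d - set b) \<le> card (set d' - set b)"
    using ex_has_least_nat[of "\<lambda>d. \<psi> d \<noteq> 0" _ "\<lambda>d. card (set d - set b)"] by blast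
  have sub: "set d \<subseteq> set b"
  proof
    fix a
    assume a: "a \<in> set d"
    show "a \<in> set b"
    proof (rule ccontr)
      assume "a \<notin> set b"
      then obtain x e where "\<psi> (e # x) \<noteq> 0" "card (set (e # x) - set b) < card (set d - set b)"
        using exchange[OF \<phi> \<psi> cross b d a] by metis
      then show False
        using least[of "e # x"] by linarith
    qed
  qed
  note pb = gp_nonzeroD[OF \<phi> b] and pd = gp_nonzeroD[OF \<psi> d]
  have cards: "card (set b) = r" "card (set d) = r'"
    using pb pd distinct_card by metis+
  then have "r' \<le> r"
    using card_mono[OF _ sub] by simp
  moreover have "\<psi> b \<noteq> 0" if "r = r'"
  proof -
    have "set d = set b"
      using sub cards that by (intro card_subset_eq) auto
    then have "mset d = mset b"
      using pb(3) pd(3) set_eq_iff_mset_eq_distinct by blast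
    then obtain s :: 'f where "\<And>E r \<phi>. grassmann_pluecker E r \<phi> \<Longrightarrow> \<phi> d = s * \<phi> b"
      using gp_rearrange by metis
    then show ?thesis
      using d \<psi> by fastforce
  qed
  ultimately show ?thesis
    by blast
qed

text \<open>
  The ratio of the two functions is the same at two bases that differ in one entry, because the
  relation for \<open>[a, e] @ x\<close> has two terms only.  Exchange connects any two bases.
\<close>

lemma orthogonal_proportional:
  fixes \<phi> \<psi> :: "'e list \<Rightarrow> 'f::idyll"
  assumes \<phi>: "grassmann_pluecker E r \<phi>" and \<psi>: "grassmann_pluecker E r' \<psi>"
    and cross: "\<And>x. set x \<subseteq> E \<Longrightarrow> Suc (length x) = r' \<Longrightarrow> minor_orthogonal E r \<phi> (\<lambda>e. \<psi> (e # x))"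
    and cross': "\<And>x. set x \<subseteq> E \<Longrightarrow> Suc (length x) = r \<Longrightarrow> minor_orthogonal E r' \<psi> (\<lambda>e. \<phi> (e # x))"
  obtains t where "r = r'" "t \<noteq> 0" "\<And>x. \<psi> x = t * \<phi> x"
proof -
  obtain b where b: "\<phi> b \<noteq> 0"
    using \<phi> unfolding grassmann_pluecker_def by blast
  obtain b' where b': "\<psi> b' \<noteq> 0"
    using \<psi> unfolding grassmann_pluecker_def by blast
  have rank: "r' = r"
    using orthogonal_support[OF \<phi> \<psi> cross b] orthogonal_support[OF \<psi> \<phi> cross' b'] by simp
  have \<psi>_nz: "\<psi> y \<noteq> 0" if "\<phi> y \<noteq> 0" for y
    using orthogonal_support[OF \<phi> \<psi> cross that] rank by simp
  have \<phi>_nz: "\<phi> y \<noteq> 0" if "\<psi> y \<noteq> 0" for y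
    using orthogonal_support[OF \<psi> \<phi> cross' that] rank by simp
  have \<psi>_row: "minor_orthogonal E r \<psi> (\<lambda>e. \<psi> (e # x))" if "set x \<subseteq> E" "Suc (length x) = r" for x
    using row_minor_orthogonal[of E r \<psi> x] \<psi> that rank by simp
  obtain i where i: "i \<noteq> 0" "\<And>z. \<phi> b * (i * z) = z"
    using idyll_inverse[OF b] by metis
  define t where "t = i * \<psi> b"
  have "t * \<phi> b = \<phi> b * (i * \<psi> b)"
    by (simp only: t_def mult_ac)
  then have t: "t \<noteq> 0" "\<psi> b = t * \<phi> b"
    using i \<psi>_nz[OF b] by (simp_all add: t_def)
  have main: "\<psi> d = t * \<phi> d" if "\<psi> d \<noteq> 0" for d
    using that
  proof (induction "card (set d - set b)" arbitrary: d rule: less_induct)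
    case less
    note pb = gp_nonzeroD[OF \<phi> b] and pd = gp_nonzeroD[OF \<psi> less.prems]
    show ?case
    proof (cases "set d \<subseteq> set b")
      case True
      have "card (set b) = r" "card (set d) = r"
        using pb pd rank distinct_card by metis+
      then have "set d = set b"
        using True by (intro card_subset_eq) auto
      then have "mset d = mset b"
        using pb(3) pd(3) set_eq_iff_mset_eq_distinct by blast
      then obtain s :: 'f where s: "\<And>E r \<phi>. grassmann_pluecker E r \<phi> \<Longrightarrow> \<phi> d = s * \<phi> b"
        using gp_rearrange by metis
      then show ?thesis
        using s[OF \<phi>] s[OF \<psi>] t(2) by (simp add: mult.left_commute)
    next
      case False
      then obtain a where a: "a \<in> set d" "a \<notin> set b"
        by blast
      obtain x e where mset: "mset d = mset (a # x)" and ax: "\<psi> (a # x) \<noteq> 0"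
        and e: "e \<in> set b" "\<psi> (e # x) \<noteq> 0"
        and closer: "card (set (e # x) - set b) < card (set d - set b)"
        using exchange[OF \<psi> \<psi> _ \<psi>_nz[OF b] less.prems a] \<psi>_row rank by metis
      have IH: "\<psi> (e # x) = t * \<phi> (e # x)"
        by (rule less.hyps[OF closer e(2)])
      have x: "set x \<subseteq> E" "Suc (length x) = r" "a \<in> E" "e \<in> E" "a \<noteq> e"
        using gp_nonzeroD[OF \<psi> ax] gp_nonzeroD[OF \<psi> e(2)] a e rank by auto
      let ?y = "a # e # x"
      let ?f = "\<lambda>k. neg_one ^ k * \<phi> (omit k ?y) * \<psi> (?y ! k # x)"
      have "?y \<in> tuples E (Suc r)"
        using x by (simp add: tuples_def)
      then have "null_sum ?f {..r}"
        using cross[of x] x rank unfolding minor_orthogonal_def by blast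
      moreover have "?f k = 0" if "k \<in> {..r}" "k \<noteq> 0" "k \<noteq> 1" for k
      proof -
        obtain m where m: "k = Suc (Suc m)"
          using \<open>k \<noteq> 0\<close> \<open>k \<noteq> 1\<close> by (metis One_nat_def not0_implies_Suc)
        then have "x ! m \<in> set x"
          using that(1) x(2) by auto
        then have "\<psi> (x ! m # x) = 0"
          using gp_nonzeroD(3)[OF \<psi>, of "x ! m # x"] by auto
        then show ?thesis
          by (simp add: m)
      qed
      moreover have "?f 0 \<noteq> 0"
        using \<phi>_nz[OF e(2)] ax by simp
      moreover have "(0 :: nat) \<in> {..r}" "(1 :: nat) \<in> {..r}"
        using x(2) by auto
      ultimately have "?f 1 = neg_one * ?f 0"
        using null_sum_pair[of "{..r}" 0 1 ?f] by auto
      then have "\<phi> (a # x) * \<psi> (e # x) = \<phi> (e # x) * \<psi> (a # x)"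
        by (simp add: idyll_mult_left_cancel neg_one mult.assoc)
      then have "\<phi> (e # x) * \<psi> (a # x) = \<phi> (e # x) * (t * \<phi> (a # x))"
        unfolding IH by (simp only: mult_ac)
      then have "\<psi> (a # x) = t * \<phi> (a # x)"
        using idyll_mult_left_cancel[OF \<phi>_nz[OF e(2)]] by blast
      moreover obtain s :: 'f
        where s: "\<And>E r \<phi>. grassmann_pluecker E r \<phi> \<Longrightarrow> \<phi> d = s * \<phi> (a # x)"
        using gp_rearrange[OF mset] by metis
      ultimately show ?thesis
        using s[OF \<phi>] s[OF \<psi>] by (simp add: mult.left_commute)
    qed
  qed
  have "\<psi> x = t * \<phi> x" for x
    using main[of x] \<psi>_nz[of x] t(1) by (cases "\<psi> x = 0") auto
  then show thesis
    using that[OF rank[symmetric] t(1)] by blast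
qed

lemma gp_class_scale:
  fixes \<phi> :: "'e list \<Rightarrow> 'f::idyll"
  assumes "t \<noteq> 0"
  shows "gp_class (\<lambda>x. t * \<phi> x) = gp_class \<phi>"
proof -
  obtain i where i: "i \<noteq> 0" "\<And>z. t * (i * z) = z"
    using idyll_inverse[OF assms] by metis
  show ?thesis
    unfolding gp_class_def
  proof (rule Collect_cong, rule iffI; elim exE conjE)
    fix \<chi> a
    assume "\<chi> = (\<lambda>x. a * (t * \<phi> x))" "a \<noteq> 0"
    then show "\<exists>d. \<chi> = (\<lambda>x. d * \<phi> x) \<and> d \<noteq> 0"
      using assms by (intro exI[of _ "a * t"]) (simp add: mult.assoc)
  next
    fix \<chi> a
    assume a: "\<chi> = (\<lambda>x. a * \<phi> x)" "a \<noteq> 0"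
    have "a * i * (t * z) = a * z" for z
      using i(2)[of z] by (simp add: mult.assoc mult.left_commute[of i])
    then show "\<exists>d. \<chi> = (\<lambda>x. d * (t * \<phi> x)) \<and> d \<noteq> 0"
      using a i(1) by (intro exI[of _ "a * i"]) simp
  qed
qed

lemma fmatroid_determined_by_vectors:
  fixes P Q :: "('e, 'f::idyll) fmatroid"
  assumes "is_fmatroid P" "is_fmatroid Q" "ground P = ground Q" "vectors P = vectors Q"
  shows "P = Q"
proof -
  obtain E r \<phi> where E: "finite E" and \<phi>: "grassmann_pluecker E r \<phi>" and P: "P = fmatroid_of E r \<phi>"
    using assms(1) unfolding is_fmatroid_def by blast
  obtain E' r' \<psi> where \<psi>': "grassmann_pluecker E' r' \<psi>" and Q': "Q = fmatroid_of E' r' \<psi>"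
    using assms(2) unfolding is_fmatroid_def by blast
  have "E' = E"
    using assms(3) unfolding P Q' by (simp add: fmatroid_of_def)
  note \<psi> = \<psi>'[unfolded this] and Q = Q'[unfolded this]
  have cross: "minor_orthogonal E q \<alpha> (\<lambda>e. \<beta> (e # x))"
    if \<alpha>: "grassmann_pluecker E q \<alpha>" and \<beta>: "grassmann_pluecker E q' \<beta>"
      and eq: "vectors (fmatroid_of E q \<alpha>) = vectors (fmatroid_of E q' \<beta>)"
      and x: "set x \<subseteq> E" "Suc (length x) = q'"
    for q q' x and \<alpha> \<beta> :: "'e list \<Rightarrow> 'f"
  proof -
    have "perp E X (\<lambda>e. \<beta> (e # x))" if "X \<in> circuits (fmatroid_of E q \<alpha>)" for X
    proof -
      have "X \<in> vectors (fmatroid_of E q' \<beta>)"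
        using circuits_subset_vectors[OF E \<alpha>] eq that by blast
      then have "row_orthogonal E q' \<beta> X"
        using vectors_iff[OF E \<beta>] by simp
      then show ?thesis
        using x unfolding row_orthogonal_def perp_def by simp
    qed
    then show ?thesis
      unfolding minor_orthogonal_iff_circuits[OF E \<alpha>, symmetric] by simp
  qed
  have eq: "vectors (fmatroid_of E r \<phi>) = vectors (fmatroid_of E r' \<psi>)"
    using assms(4) P Q by simp
  obtain t where t: "r = r'" "t \<noteq> 0" "\<And>x. \<psi> x = t * \<phi> x"
    using orthogonal_proportional[OF \<phi> \<psi> cross[OF \<phi> \<psi> eq] cross[OF \<psi> \<phi> eq[symmetric]]] by metis
  have "\<psi> = (\<lambda>x. t * \<phi> x)"
    using t(3) by (rule ext)
  then have "gp_class \<psi> = gp_class \<phi>"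
    using gp_class_scale[OF t(2)] by simp
  then show ?thesis
    unfolding P Q fmatroid_of_def t(1) by simp
qed

section \<open>Submonomial matrices\<close>

text \<open>
  A zero column has entry 0 and an unspecified row, so that the convention on the adjoined point
  takes the form of a product with a zero factor.
\<close>

definition column_entry :: "'t set \<Rightarrow> ('t \<Rightarrow> 's \<Rightarrow> 'f::idyll) \<Rightarrow> 's \<Rightarrow> 'f" where
  "column_entry T \<Phi> j = entry0 \<Phi> (underlying_map T \<Phi> (Some j)) j"

definition column_row :: "'t set \<Rightarrow> ('t \<Rightarrow> 's \<Rightarrow> 'f::idyll) \<Rightarrow> 's \<Rightarrow> 't" where
  "column_row T \<Phi> j = the (underlying_map T \<Phi> (Some j))"

lemma entry0_eval0:
  "entry0 \<Phi> (underlying_map T \<Phi> (Some j)) j * eval0 \<mu> (underlying_map T \<Phi> (Some j)) x =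
    column_entry T \<Phi> j * \<mu> (column_row T \<Phi> j # x)"
  by (cases "underlying_map T \<Phi> (Some j)") (simp_all add: column_entry_def column_row_def)

context
  fixes S :: "'s set" and T :: "'t set" and \<Phi> :: "'t \<Rightarrow> 's \<Rightarrow> 'f::idyll"
  assumes sub: "submonomial T S \<Phi>"
begin

lemma column_row_eq:
  assumes "i \<in> T" "j \<in> S" "\<Phi> i j \<noteq> 0"
  shows "column_row T \<Phi> j = i" "column_entry T \<Phi> j = \<Phi> i j"
proof -
  have "(THE i. i \<in> T \<and> \<Phi> i j \<noteq> 0) = i"
    by (rule the_equality) (use assms sub in \<open>auto simp: submonomial_def\<close>)
  then show "column_row T \<Phi> j = i" "column_entry T \<Phi> j = \<Phi> i j"
    using assms by (auto simp: column_row_def column_entry_def)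
qed

lemma column_entry_nonzero:
  assumes "j \<in> S" "column_entry T \<Phi> j \<noteq> 0"
  shows "column_row T \<Phi> j \<in> T" "\<Phi> (column_row T \<Phi> j) j \<noteq> 0"
proof -
  obtain i where "i \<in> T" "\<Phi> i j \<noteq> 0"
    using assms(2) by (force simp: column_entry_def split: if_splits)
  then show "column_row T \<Phi> j \<in> T" "\<Phi> (column_row T \<Phi> j) j \<noteq> 0"
    using column_row_eq(1)[of i j] assms(1) by auto
qed

lemma mat_apply_eq:
  assumes "i \<in> T" "j \<in> S" "\<Phi> i j \<noteq> 0"
  shows "mat_apply T S \<Phi> X i = \<Phi> i j * X j"
proof -
  have "(THE j. j \<in> S \<and> \<Phi> i j \<noteq> 0) = j"
    by (rule the_equality) (use assms sub in \<open>auto simp: submonomial_def\<close>)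
  then show ?thesis
    using assms by (auto simp: mat_apply_def)
qed

text \<open>
  The transpose of \<open>\<Phi>\<close> is adjoint to \<open>\<Phi>\<close>, even as an identity of formal sums: the nonzero terms
  correspond under the bijection from nonzero columns to nonzero rows.
\<close>

lemma mat_apply_adjoint:
  assumes "finite S" "finite T"
  shows "formal_sum (\<lambda>i. mat_apply T S \<Phi> X i * Y i) T =
    formal_sum (\<lambda>j. X j * (column_entry T \<Phi> j * Y (column_row T \<Phi> j))) S"
proof -
  define S' where "S' = {j \<in> S. column_entry T \<Phi> j \<noteq> 0}"
  have inj: "inj_on (column_row T \<Phi>) S'"
  proof (rule inj_onI)
    fix j j'
    assume "j \<in> S'" "j' \<in> S'" "column_row T \<Phi> j = column_row T \<Phi> j'"
    then show "j = j'"
      using column_entry_nonzero[of j] column_entry_nonzero[of j'] sub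
      unfolding submonomial_def S'_def by (metis (mono_tags, lifting) mem_Collect_eq)
  qed
  have "formal_sum (\<lambda>i. mat_apply T S \<Phi> X i * Y i) T =
      formal_sum (\<lambda>i. mat_apply T S \<Phi> X i * Y i) (column_row T \<Phi> ` S')"
  proof (rule formal_sum_restrict[OF assms(2)])
    show "column_row T \<Phi> ` S' \<subseteq> T"
      using column_entry_nonzero by (auto simp: S'_def)
    fix i
    assume i: "i \<in> T - column_row T \<Phi> ` S'"
    have "\<Phi> i j = 0" if "j \<in> S" for j
    proof (rule ccontr)
      assume "\<Phi> i j \<noteq> 0"
      then have "j \<in> S'" "column_row T \<Phi> j = i"
        using column_row_eq[of i j] i that by (auto simp: S'_def)
      then show False
        using i by blast
    qed
    then show "mat_apply T S \<Phi> X i * Y i = 0"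
      by (simp add: mat_apply_def)
  qed
  also have "\<dots> = formal_sum (\<lambda>j. mat_apply T S \<Phi> X (column_row T \<Phi> j) * Y (column_row T \<Phi> j)) S'"
    by (rule formal_sum_reindex[OF inj])
  also have "\<dots> = formal_sum (\<lambda>j. X j * (column_entry T \<Phi> j * Y (column_row T \<Phi> j))) S'"
  proof (rule formal_sum_cong)
    fix j
    assume "j \<in> S'"
    then have j: "j \<in> S" "column_entry T \<Phi> j \<noteq> 0"
      by (auto simp: S'_def)
    note nz = column_entry_nonzero[OF j]
    show "mat_apply T S \<Phi> X (column_row T \<Phi> j) * Y (column_row T \<Phi> j) =
        X j * (column_entry T \<Phi> j * Y (column_row T \<Phi> j))"
      unfolding mat_apply_eq[OF nz(1) j(1) nz(2)] column_row_eq(2)[OF nz(1) j(1) nz(2)]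
      by (simp only: mult_ac)
  qed
  also have "\<dots> = formal_sum (\<lambda>j. X j * (column_entry T \<Phi> j * Y (column_row T \<Phi> j))) S"
    by (rule formal_sum_restrict[symmetric]) (use assms(1) in \<open>auto simp: S'_def\<close>)
  finally show ?thesis .
qed

end


section \<open>Preimages and morphisms\<close>

lemma mat_apply_vecs: "mat_apply T S \<Phi> X \<in> vecs T"
  by (simp add: vecs_def mat_apply_def)

text \<open>
  The witness is the pullback along the columns of \<open>\<Phi>\<close>.  A vector of the pullback is mapped to a
  vector of \<open>M\<close> because the cocircuits of \<open>M\<close> pull back to covectors, which are orthogonal to it by
  perfection.  The converse holds because the rows of the pullback are multiples of pulled back rows.
\<close>

lemma preimage_exists:
  fixes \<mu> :: "'t list \<Rightarrow> 'f::idyll" and \<Phi> :: "'t \<Rightarrow> 's \<Rightarrow> 'f"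
  assumes perf: "perfect_idyll TYPE('f)" and S: "finite S" and T: "finite T"
    and \<mu>: "grassmann_pluecker T r \<mu>" and sub: "submonomial T S \<Phi>"
  obtains q \<psi> where "grassmann_pluecker S q \<psi>"
    "vectors (fmatroid_of S q \<psi>) = {V \<in> vecs S. mat_apply T S \<Phi> V \<in> vectors (fmatroid_of T r \<mu>)}"
proof -
  let ?c = "column_entry T \<Phi>" and ?h = "column_row T \<Phi>"
  \<comment> \<open>Any basis of \<open>M\<close>, paired with the empty tuple, shows that a completing list exists.\<close>
  let ?good = "\<lambda>b. set b \<subseteq> T \<and> (\<exists>x. pullback_gp S ?c ?h b \<mu> x \<noteq> 0)"
  obtain b0 where b0: "\<mu> b0 \<noteq> 0"
    using \<mu> unfolding grassmann_pluecker_def by blast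
  then have "pullback_gp S ?c ?h b0 \<mu> [] \<noteq> 0"
    by (simp add: pullback_gp_def)
  then have "?good b0"
    using gp_nonzeroD(2)[OF \<mu> b0] by blast
  then obtain b where b: "?good b" and least: "\<And>b'. ?good b' \<Longrightarrow> length b \<le> length b'"
    using ex_has_least_nat[of ?good b0 length] by blast
  have shorter: "pullback_gp S ?c ?h b' \<mu> x = 0" if "set b' \<subseteq> T" "length b' < length b" for b' x
    using least[of b'] that by (meson linorder_not_less)
  obtain x0 where "pullback_gp S ?c ?h b \<mu> x0 \<noteq> 0"
    using b by blast
  then have "\<mu> (map ?h x0 @ b) \<noteq> 0"
    by (auto simp: pullback_gp_def split: if_splits)
  then have "length b \<le> r"
    using gp_nonzeroD(1)[OF \<mu>] by fastforce
  define q where "q = r - length b"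
  have q: "q + length b = r"
    using \<open>length b \<le> r\<close> by (simp add: q_def)
  let ?\<psi> = "pullback_gp S ?c ?h b \<mu>"
  have h: "?h s \<in> T" if "s \<in> S" "?c s \<noteq> 0" for s
    using column_entry_nonzero(1)[OF sub that] .
  have \<psi>: "grassmann_pluecker S q ?\<psi>"
    by (rule pullback_grassmann_pluecker[OF \<mu> h _ q shorter]) (use b in auto)
  have pulled: "row_orthogonal T r \<mu> (mat_apply T S \<Phi> V) \<longleftrightarrow>
      (\<forall>x. set x \<subseteq> T \<and> Suc (length x) = r \<longrightarrow> null_sum (\<lambda>s. V s * (?c s * \<mu> (?h s # x))) S)" for V
    unfolding row_orthogonal_def mat_apply_adjoint[OF sub S T] ..
  have "row_orthogonal S q ?\<psi> V \<longleftrightarrow> row_orthogonal T r \<mu> (mat_apply T S \<Phi> V)" for V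
  proof
    assume V: "row_orthogonal S q ?\<psi> V"
    show "row_orthogonal T r \<mu> (mat_apply T S \<Phi> V)"
      unfolding pulled
    proof (intro allI impI, elim conjE)
      fix x
      assume x: "set x \<subseteq> T" "Suc (length x) = r"
      have "minor_orthogonal S q ?\<psi> (\<lambda>s. ?c s * \<mu> (?h s # x))"
        by (rule pullback_minor_orthogonal[OF \<mu> h _ q shorter row_minor_orthogonal[OF \<mu> x]]) (use b in auto)
      then show "null_sum (\<lambda>s. V s * (?c s * \<mu> (?h s # x))) S"
        by (rule perfect_orthogonal[OF perf S \<psi> V])
    qed
  next
    assume "row_orthogonal T r \<mu> (mat_apply T S \<Phi> V)"
    then have V: "null_sum (\<lambda>s. V s * (?c s * \<mu> (?h s # x))) S"
      if "set x \<subseteq> T" "Suc (length x) = r" for x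
      unfolding pulled using that by blast
    show "row_orthogonal S q ?\<psi> V"
      by (rule pullback_row_orthogonal[OF \<mu> h _ q shorter V]) (use b in auto)
  qed
  then have "vectors (fmatroid_of S q ?\<psi>) =
      {V \<in> vecs S. mat_apply T S \<Phi> V \<in> vectors (fmatroid_of T r \<mu>)}"
    using vectors_iff[OF S \<psi>] vectors_iff[OF T \<mu>] mat_apply_vecs[of T S \<Phi>] by auto
  with \<psi> show thesis
    by (rule that)
qed

lemma preimage_matroid:
  fixes \<mu> :: "'t list \<Rightarrow> 'f::idyll" and \<Phi> :: "'t \<Rightarrow> 's \<Rightarrow> 'f"
  assumes "perfect_idyll TYPE('f)" "finite S" "finite T"
    and "grassmann_pluecker T r \<mu>" "submonomial T S \<Phi>" "M = fmatroid_of T r \<mu>"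
  defines "P \<equiv> preimage_matroid S \<Phi> M"
  shows "is_fmatroid P" "ground P = S" "vectors P = {V \<in> vecs S. mat_apply T S \<Phi> V \<in> vectors M}"
proof -
  have T: "ground M = T"
    using assms(6) by (simp add: fmatroid_of_def)
  let ?is = "\<lambda>P. is_fmatroid P \<and> ground P = S \<and>
    vectors P = {V \<in> vecs S. mat_apply (ground M) S \<Phi> V \<in> vectors M}"
  obtain q \<psi> where \<psi>: "grassmann_pluecker S q \<psi>"
    "vectors (fmatroid_of S q \<psi>) = {V \<in> vecs S. mat_apply T S \<Phi> V \<in> vectors (fmatroid_of T r \<mu>)}"
    using preimage_exists[OF assms(1-5)] by blast
  have "?is (fmatroid_of S q \<psi>)"
    using \<psi> assms(2,6) T unfolding is_fmatroid_def by (auto simp: fmatroid_of_def)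
  then have "\<exists>!P. ?is P"
    using fmatroid_determined_by_vectors by (metis (no_types, lifting))
  then have "?is P"
    unfolding P_def preimage_matroid_def by (rule theI')
  then show "is_fmatroid P" "ground P = S" "vectors P = {V \<in> vecs S. mat_apply T S \<Phi> V \<in> vectors M}"
    unfolding T by blast+
qed

theorem theoremE:
  fixes S :: "'s set" and T :: "'t set"
    and \<nu> :: "'s list \<Rightarrow> 'f::idyll" and \<mu> :: "'t list \<Rightarrow> 'f"
    and N :: "('s, 'f) fmatroid" and M :: "('t, 'f) fmatroid"
    and \<Phi> :: "'t \<Rightarrow> 's \<Rightarrow> 'f" and w r :: nat
  assumes "perfect_idyll TYPE('f)"
    and "finite S" and "finite T"
    and "grassmann_pluecker S w \<nu>" and "N = fmatroid_of S w \<nu>"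
    and "grassmann_pluecker T r \<mu>" and "M = fmatroid_of T r \<mu>"
    and "submonomial T S \<Phi>"
  shows "(is_morphism \<Phi> N M \<longleftrightarrow> is_quotient (preimage_matroid S \<Phi> M) N) \<and>
    (is_morphism \<Phi> N M \<longleftrightarrow> perp_sets T (mat_apply T S \<Phi> ` circuits N) (cocircuits M)) \<and>
    (is_morphism \<Phi> N M \<longleftrightarrow>
      (\<forall>y x. y \<in> tuples S (Suc w) \<and> set x \<subseteq> T \<and> Suc (length x) = r \<longrightarrow>
        formal_sum (\<lambda>k. neg_one ^ k * \<nu> (omit k y)
            * entry0 \<Phi> (underlying_map T \<Phi> (Some (y ! k))) (y ! k)
            * eval0 \<mu> (underlying_map T \<Phi> (Some (y ! k))) x) {..w} \<in> nullset))"
proof -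
  note S = assms(2) and T = assms(3) and \<nu> = assms(4) and N = assms(5)
    and \<mu> = assms(6) and M = assms(7) and sub = assms(8)
  note P = preimage_matroid[OF assms(1) S T \<mu> sub M]
  let ?row = "\<lambda>x s. column_entry T \<Phi> s * \<mu> (column_row T \<Phi> s # x)"
  \<comment> \<open>the pulled back cocircuits of \<open>M\<close> are covectors of \<open>N\<close>\<close>
  define pulled_rows where "pulled_rows \<longleftrightarrow>
    (\<forall>x. set x \<subseteq> T \<and> Suc (length x) = r \<longrightarrow> minor_orthogonal S w \<nu> (?row x))"
  have ground: "ground N = S" "ground M = T"
    using N M by (simp_all add: fmatroid_of_def)
  have in_M: "mat_apply T S \<Phi> X \<in> vectors M \<longleftrightarrow>
      (\<forall>x. set x \<subseteq> T \<and> Suc (length x) = r \<longrightarrow> null_sum (\<lambda>s. X s * ?row x s) S)" for X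
    unfolding M vectors_iff[OF T \<mu>] row_orthogonal_def mat_apply_adjoint[OF sub S T]
    using mat_apply_vecs[of T S \<Phi> X] by blast
  have morphism: "is_morphism \<Phi> N M \<longleftrightarrow> (\<forall>X\<in>vectors N. mat_apply T S \<Phi> X \<in> vectors M)"
    using sub by (auto simp: is_morphism_def ground)
  have circuits: "(\<forall>X\<in>circuits N. mat_apply T S \<Phi> X \<in> vectors M) \<longleftrightarrow> pulled_rows"
    unfolding in_M pulled_rows_def minor_orthogonal_iff_circuits[OF S \<nu>, folded N, symmetric] perp_def
    by blast
  have three: "perp_sets T (mat_apply T S \<Phi> ` circuits N) (cocircuits M) \<longleftrightarrow> pulled_rows"
    unfolding circuits[symmetric] perp_sets_def
    using mat_apply_vecs[of T S \<Phi>] by (simp add: vectors_def ground)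
  have "is_morphism \<Phi> N M \<longleftrightarrow> pulled_rows"
  proof
    assume "is_morphism \<Phi> N M"
    then show pulled_rows
      unfolding circuits[symmetric] morphism using circuits_subset_vectors[OF S \<nu>] N by blast
  next
    assume rows: pulled_rows
    show "is_morphism \<Phi> N M"
      unfolding morphism in_M
    proof (intro ballI allI impI)
      fix X x
      assume "X \<in> vectors N" "set x \<subseteq> T \<and> Suc (length x) = r"
      then show "null_sum (\<lambda>s. X s * ?row x s) S"
        using rows perfect_orthogonal[OF assms(1) S \<nu>, of X "?row x"] vectors_iff[OF S \<nu>, of X]
        unfolding N pulled_rows_def by blast
    qed
  qed
  moreover have "is_morphism \<Phi> N M \<longleftrightarrow> is_quotient (preimage_matroid S \<Phi> M) N"
  proof -
    have "is_fmatroid N"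
      using S \<nu> N unfolding is_fmatroid_def by blast
    moreover have "vectors N \<subseteq> vecs S"
      using vectors_iff[OF S \<nu>] N by blast
    ultimately show ?thesis
      unfolding morphism is_quotient_def using P by (auto simp: ground)
  qed
  moreover have "pulled_rows \<longleftrightarrow> (\<forall>y x. y \<in> tuples S (Suc w) \<and> set x \<subseteq> T \<and> Suc (length x) = r \<longrightarrow>
        formal_sum (\<lambda>k. neg_one ^ k * \<nu> (omit k y)
            * entry0 \<Phi> (underlying_map T \<Phi> (Some (y ! k))) (y ! k)
            * eval0 \<mu> (underlying_map T \<Phi> (Some (y ! k))) x) {..w} \<in> nullset)"
    unfolding pulled_rows_def minor_orthogonal_def mult.assoc entry0_eval0 by blast
  ultimately show ?thesis
    using three by blast
qed

end
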